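(* Let $\mathcal{G}$ be a graph class closed under induced subgraphs, and let $\beta\in(0,1)$. Suppose there is a constant $c$ such that for every positive integer $n$, every $n$-vertex graph in $\mathcal{G}$ has a $\frac12$-balanced separator of size at most $c\,n^{\beta}$. Then there exists a constant $C$ (depending only on $\mathcal{G}$ and $\beta$) such that for every positive integer $n$ and every $n$-vertex graph $G\in\mathcal{G}$, the forest polytope $\mathrm{P}^{\downarrow}(G)$ satisfies $\mathrm{xc}(\mathrm{P}^{\downarrow}(G))\leq C\,n^{1+\beta}$.
   Context: Graphs are finite, simple and undirected. A graph class is a family of graphs closed under isomorphism; it is closed under induced subgraphs if it contains every induced subgraph of each of its members. For $\alpha\in(0,1)$, an $\alpha$-balanced separator in a graph $G$ is a set $X\subseteq V(G)$ such that $G-X$ is the disjoint union of two (possibly empty) induced subgraphs $G_1$ and $G_2$ with $|V(G_1)|,|V(G_2)|\leq\alpha|V(G)|$ (so there are no edges of $G$ between $V(G_1)$ and $V(G_2)$). The forest polytope $\mathrm{P}^{\downarrow}(G)$ of a graph $G$ is the convex hull in $\mathbb{R}^{E(G)}$ of the $0/1$ characteristic vectors of (the edge sets of) the forests of $G$. An extended formulation of a polytope $P\subseteq\mathbb{R}^d$ is a linear system $Ax+By\leq b,\ Cx+Dy=c$ in variables $x\in\mathbb{R}^d$, $y\in\mathbb{R}^k$ (for some $k$) such that $P=\{x\in\mathbb{R}^d \mid \exists y\in\mathbb{R}^k: Ax+By\leq b,\ Cx+Dy=c\}$. Its size is its number of inequalities (equalities are not counted). The extension complexity $\mathrm{xc}(P)$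 is the minimum size of an extended formulation of $P$. *)

theory Defs
  imports "HOL-Analysis.Analysis" "HOL-Analysis.Finite_Function_Topology"
begin

section \<open>Finite simple graphs\<close>

record 'a ugraph =
  verts :: "'a set"
  edges :: "'a set set"

definition simple_graph :: "'a ugraph \<Rightarrow> bool" where
  "simple_graph G \<longleftrightarrow> finite (verts G) \<and> (\<forall>e\<in>edges G. e \<subseteq> verts G \<and> card e = 2)"

definition graph_iso :: "'a ugraph \<Rightarrow> 'a ugraph \<Rightarrow> bool" where
  "graph_iso G H \<longleftrightarrow>
     (\<exists>f. bij_betw f (verts G) (verts H) \<and>
          (\<forall>u\<in>verts G. \<forall>v\<in>verts G. {u, v} \<in> edges G \<longleftrightarrow> {f u, f v} \<in> edges H))"

definition induced :: "'a ugraph \<Rightarrow> 'a set \<Rightarrow> 'a ugraph" where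
  "induced G W = \<lparr>verts = W, edges = {e \<in> edges G. e \<subseteq> W}\<rparr>"

definition graph_union :: "'a ugraph \<Rightarrow> 'a ugraph \<Rightarrow> 'a ugraph" where
  "graph_union G H = \<lparr>verts = verts G \<union> verts H, edges = edges G \<union> edges H\<rparr>"

definition subgraph :: "'a ugraph \<Rightarrow> 'a ugraph \<Rightarrow> bool" where
  "subgraph H G \<longleftrightarrow> simple_graph H \<and> verts H \<subseteq> verts G \<and> edges H \<subseteq> edges G"

text \<open>A cycle is given by the cyclic sequence of its vertices.\<close>

definition is_cycle :: "'a ugraph \<Rightarrow> 'a list \<Rightarrow> bool" where
  "is_cycle G vs \<longleftrightarrow> 3 \<le> length vs \<and> distinct vs \<and>
     (\<forall>i<length vs. {vs ! i, vs ! (Suc i mod length vs)} \<in> edges G)"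

definition forest :: "'a ugraph \<Rightarrow> bool" where
  "forest G \<longleftrightarrow> simple_graph G \<and> (\<nexists>vs. is_cycle G vs)"


section \<open>Graph classes and balanced separators\<close>

text \<open>
  All members of a class have their vertices in the type \<open>'a\<close>. For an infinite type
  such as \<open>nat\<close>, every finite graph has an isomorphic copy of this kind.
\<close>

definition graph_class :: "'a ugraph set \<Rightarrow> bool" where
  "graph_class \<G> \<longleftrightarrow> (\<forall>G\<in>\<G>. simple_graph G) \<and>
     (\<forall>G\<in>\<G>. \<forall>H. simple_graph H \<and> graph_iso G H \<longrightarrow> H \<in> \<G>)"

definition closed_under_induced_subgraphs :: "'a ugraph set \<Rightarrow> bool" where
  "closed_under_induced_subgraphs \<G> \<longleftrightarrow> (\<forall>G\<in>\<G>. \<forall>W. W \<subseteq> verts G \<longrightarrow> induced G W \<in> \<G>)"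

definition balanced_separator :: "real \<Rightarrow> 'a ugraph \<Rightarrow> 'a set \<Rightarrow> bool" where
  "balanced_separator \<alpha> G X \<longleftrightarrow> X \<subseteq> verts G \<and>
     (\<exists>V\<^sub>1 V\<^sub>2. V\<^sub>1 \<inter> V\<^sub>2 = {} \<and>
        induced G (verts G - X) = graph_union (induced G V\<^sub>1) (induced G V\<^sub>2) \<and>
        real (card V\<^sub>1) \<le> \<alpha> * real (card (verts G)) \<and>
        real (card V\<^sub>2) \<le> \<alpha> * real (card (verts G)))"


section \<open>Extended formulations\<close>

text \<open>
  For a finite set \<open>I\<close>, the space \<open>\<real>\<^sup>I\<close> is represented by the finitely supported functions
  with support contained in \<open>I\<close>; this is a linear subspace of the real vector space
  \<^typ>\<open>'i \<Rightarrow>\<^sub>0 real\<close>, so that \<open>convex hull\<close> has its usual meaning.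

  In the following definition \<open>A, B, b\<close> are the data of \<open>m\<close> inequalities and \<open>C, D, d\<close> those of
  \<open>p\<close> equalities, in the variables \<open>x \<in> \<real>\<^sup>I\<close> and \<open>y \<in> \<real>\<^sup>k\<close>. Only the entries with indices
  below \<open>m\<close>, \<open>p\<close>, \<open>k\<close> are used.
\<close>

definition has_extended_formulation :: "'i set \<Rightarrow> ('i \<Rightarrow>\<^sub>0 real) set \<Rightarrow> nat \<Rightarrow> bool" where
  "has_extended_formulation I P m \<longleftrightarrow>
     (\<exists>(k::nat) (p::nat)
        (A :: nat \<Rightarrow> 'i \<Rightarrow> real) (B :: nat \<Rightarrow> nat \<Rightarrow> real) (b :: nat \<Rightarrow> real)
        (C :: nat \<Rightarrow> 'i \<Rightarrow> real) (D :: nat \<Rightarrow> nat \<Rightarrow> real) (d :: nat \<Rightarrow> real).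
        P = {x. Poly_Mapping.keys x \<subseteq> I \<and>
               (\<exists>y :: nat \<Rightarrow> real.
                  (\<forall>i<m. (\<Sum>e\<in>I. A i e * Poly_Mapping.lookup x e) + (\<Sum>j<k. B i j * y j) \<le> b i) \<and>
                  (\<forall>i<p. (\<Sum>e\<in>I. C i e * Poly_Mapping.lookup x e) + (\<Sum>j<k. D i j * y j) = d i))})"

text \<open>The value is \<open>\<infinity>\<close> if there is no extended formulation, i.e. if \<open>P\<close> is not a polyhedron.\<close>

definition xc :: "'i set \<Rightarrow> ('i \<Rightarrow>\<^sub>0 real) set \<Rightarrow> enat" where
  "xc I P = (INF m\<in>{m. has_extended_formulation I P m}. enat m)"


section \<open>The forest polytope\<close>

definition char_vec :: "'i set \<Rightarrow> ('i \<Rightarrow>\<^sub>0 real)" where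
  "char_vec F = (\<Sum>e\<in>F. Poly_Mapping.single e 1)"

lemma lookup_char_vec:
  assumes "finite F"
  shows "Poly_Mapping.lookup (char_vec F) e = (if e \<in> F then 1 else 0)"
  using assms by (simp add: char_vec_def lookup_sum lookup_single when_def)

definition forest_polytope :: "'a ugraph \<Rightarrow> ('a set \<Rightarrow>\<^sub>0 real) set" where
  "forest_polytope G = convex hull {char_vec (edges F) | F. subgraph F G \<and> forest F}"

end

theory Submission
  imports Defs "HOL-Real_Asymp.Real_Asymp"
begin

text \<open>
  By Edmonds, the forest polytope of \<open>G\<close> is described by \<open>x \<ge> 0\<close> and
  \<open>x(E(U)) \<le> |U| - 1\<close> for nonempty vertex sets \<open>U\<close>. All constraints whose \<open>U\<close> contains a fixed
  vertex \<open>r\<close> are captured by \<open>2|E| + |V|\<close> inequalities: split the weight of each edge between its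
  two ends such that \<open>r\<close> receives nothing and every other vertex receives at most 1; for a forest,
  orient the edges away from \<open>r\<close>. Given a separator \<open>X\<close>, use this system for every root
  \<open>r \<in> X\<close>; the remaining sets \<open>U\<close> are disjoint from \<open>X\<close> and are handled by recursion in the two
  sides. Graphs with sublinear separators have \<open>O(n)\<close> edges, so a step costs \<open>O(n^(1 + \<beta>))\<close>, and
  these costs decrease geometrically along the levels of the recursion.
\<close>

text \<open>The orientation systems for all \<open>n\<close> roots would already describe the
  polytope, with about \<open>n * (|E| + n)\<close> inequalities. The separator cuts the number of
  roots to \<open>O(n^\<beta>)\<close>, and closure under induced subgraphs supplies separators for
  the sides as well. The sides have at most \<open>n / 2\<close> vertices each and at most
  \<open>n\<close> together, so passing to them multiplies the sum of the terms
  \<open>n^(1 + \<beta>)\<close> by at most \<open>2^(-\<beta>)\<close>; this factor is below 1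
  because \<open>\<beta> > 0\<close>. The bound \<open>\<beta> < 1\<close> enters through the linear
  edge count.

  The delicate point is that the decomposition has to be an equality of sets: a root system must not
  cut off any point of the polytope. Every forest satisfies the system of every root and the
  solutions form a convex set, so nothing is lost on the hull of the forests. To know this for all
  points satisfying Edmonds' inequalities, the integrality of these inequalities is needed; it is
  obtained by uncrossing tight vertex sets and walking to ever smaller faces.\<close>

section \<open>Extended formulations\<close>

text \<open>
  The analogue of \<^const>\<open>has_extended_formulation\<close> for sets of total functions, of which
  only the values on \<open>I\<close> matter.
\<close>

definition formulation :: "'i set \<Rightarrow> ('i \<Rightarrow> real) set \<Rightarrow> nat \<Rightarrow> bool" where
  "formulation I S m \<longleftrightarrow>
     (\<exists>(k::nat) (p::nat)
        (A :: nat \<Rightarrow> 'i \<Rightarrow> real) (B :: nat \<Rightarrow> nat \<Rightarrow> real) (b :: nat \<Rightarrow> real)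
        (C :: nat \<Rightarrow> 'i \<Rightarrow> real) (D :: nat \<Rightarrow> nat \<Rightarrow> real) (d :: nat \<Rightarrow> real).
        S = {x. \<exists>y :: nat \<Rightarrow> real.
                  (\<forall>i<m. (\<Sum>e\<in>I. A i e * x e) + (\<Sum>j<k. B i j * y j) \<le> b i) \<and>
                  (\<forall>i<p. (\<Sum>e\<in>I. C i e * x e) + (\<Sum>j<k. D i j * y j) = d i)})"

lemma formulationI:
  fixes A C :: "nat \<Rightarrow> 'i \<Rightarrow> real" and B D :: "nat \<Rightarrow> nat \<Rightarrow> real" and k p :: nat
  assumes "S = {x. \<exists>y :: nat \<Rightarrow> real.
      (\<forall>i<m. (\<Sum>e\<in>I. A i e * x e) + (\<Sum>j<k. B i j * y j) \<le> b i) \<and>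
      (\<forall>i<p. (\<Sum>e\<in>I. C i e * x e) + (\<Sum>j<k. D i j * y j) = d i)}"
  shows "formulation I S m"
  unfolding formulation_def by (intro exI, rule assms)

lemma has_extended_formulation_if_formulation:
  assumes "formulation I S m"
  shows "has_extended_formulation I {x. Poly_Mapping.keys x \<subseteq> I \<and> Poly_Mapping.lookup x \<in> S} m"
proof -
  obtain k p A B b C D d where S: "S = {x. \<exists>y :: nat \<Rightarrow> real.
      (\<forall>i<m. (\<Sum>e\<in>I. A i e * x e) + (\<Sum>j<k::nat. B i j * y j) \<le> b i) \<and>
      (\<forall>i<p::nat. (\<Sum>e\<in>I. C i e * x e) + (\<Sum>j<k. D i j * y j) = d i)}"
    using assms unfolding formulation_def by blast
  show ?thesis
    unfolding has_extended_formulation_def S mem_Collect_eq by (intro exI, rule refl)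
qed

text \<open>The orientation system is naturally indexed by incidences, vertices and edges; numbering
  such finite index sets by initial segments of the naturals gives the format of
  \<open>formulation\<close>.\<close>

lemma formulation_indexed:
  fixes A :: "'k \<Rightarrow> 'i \<Rightarrow> real" and B :: "'k \<Rightarrow> 'j \<Rightarrow> real" and C :: "'l \<Rightarrow> 'i \<Rightarrow> real" and D :: "'l \<Rightarrow> 'j \<Rightarrow> real"
  assumes fin: "finite M" "finite P" "finite J"
  shows "formulation I {x. \<exists>y. (\<forall>i\<in>M. (\<Sum>e\<in>I. A i e * x e) + (\<Sum>j\<in>J. B i j * y j) \<le> b i) \<and>
                            (\<forall>i\<in>P. (\<Sum>e\<in>I. C i e * x e) + (\<Sum>j\<in>J. D i j * y j) = d i)} (card M)"
proof -
  obtain f where f: "bij_betw f {..<card M} M"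
    using ex_bij_betw_nat_finite[OF fin(1)] by (auto simp: atLeast0LessThan)
  obtain g where g: "bij_betw g {..<card P} P"
    using ex_bij_betw_nat_finite[OF fin(2)] by (auto simp: atLeast0LessThan)
  obtain h where h: "bij_betw h {..<card J} J"
    using ex_bij_betw_nat_finite[OF fin(3)] by (auto simp: atLeast0LessThan)
  have M: "(\<forall>i\<in>M. Q i) \<longleftrightarrow> (\<forall>i<card M. Q (f i))" for Q
    using f by (force simp: bij_betw_def)
  have P: "(\<forall>i\<in>P. Q i) \<longleftrightarrow> (\<forall>i<card P. Q (g i))" for Q
    using g by (force simp: bij_betw_def)
  have J: "sum F J = (\<Sum>j<card J. F (h j))" for F :: "'j \<Rightarrow> real"
    using sum.reindex_bij_betw[OF h] by metis
  \<comment> \<open>\<open>Q\<close> reads only the first \<open>card J\<close> values of a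
    sequence, so a sequence can be pulled back along the inverse of \<open>h\<close>.\<close>
  have Y: "(\<exists>y. Q (\<lambda>j. y (h j))) \<longleftrightarrow> (\<exists>y. Q y)"
    if Q: "\<And>y y' :: nat \<Rightarrow> real. (\<And>j. j < card J \<Longrightarrow> y j = y' j) \<Longrightarrow> Q y \<longleftrightarrow> Q y'" for Q
  proof
    assume "\<exists>y. Q y"
    then obtain y where "Q y" by blast
    moreover have "y j = y (inv_into {..<card J} h (h j))" if "j < card J" for j
      using that h by (simp add: bij_betw_def)
    ultimately have "Q (\<lambda>j. y (inv_into {..<card J} h (h j)))"
      using Q[of y "\<lambda>j. y (inv_into {..<card J} h (h j))"] by simp
    then show "\<exists>y. Q (\<lambda>j. y (h j))" by (rule exI[of _ "\<lambda>j. y (inv_into {..<card J} h j)"])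
  qed blast
  have "{x. \<exists>y. (\<forall>i\<in>M. (\<Sum>e\<in>I. A i e * x e) + (\<Sum>j\<in>J. B i j * y j) \<le> b i) \<and>
                (\<forall>i\<in>P. (\<Sum>e\<in>I. C i e * x e) + (\<Sum>j\<in>J. D i j * y j) = d i)}
      = {x. \<exists>y :: nat \<Rightarrow> real.
          (\<forall>i<card M. (\<Sum>e\<in>I. A (f i) e * x e) + (\<Sum>j<card J. B (f i) (h j) * y j) \<le> b (f i)) \<and>
          (\<forall>i<card P. (\<Sum>e\<in>I. C (g i) e * x e) + (\<Sum>j<card J. D (g i) (h j) * y j) = d (g i))}"
    unfolding M P J
    by (rule Collect_cong, rule Y) auto
  then show ?thesis by (rule formulationI)
qed

lemma formulation_UNIV: "formulation I UNIV 0"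
  using formulation_indexed[of "{}" "{}" "{}" I] by simp

lemma sum_lessThan_add:
  fixes F :: "nat \<Rightarrow> 'b::comm_monoid_add"
  shows "(\<Sum>j<k + l. F j) = (\<Sum>j<k. F j) + (\<Sum>j<l. F (k + j))"
  by (induction l) (simp_all add: add.assoc)

lemma all_less_add: "(\<forall>i<m + n. Q i) \<longleftrightarrow> (\<forall>i<m. Q i) \<and> (\<forall>i<n. Q (m + i))" for m n :: nat
proof -
  have "Q i" if "\<forall>i<m. Q i" "\<forall>i<n. Q (m + i)" "i < m + n" for i
    using that by (metis add_diff_inverse_nat add_less_imp_less_left)
  then show ?thesis by auto
qed

definition join :: "nat \<Rightarrow> (nat \<Rightarrow> 'b) \<Rightarrow> (nat \<Rightarrow> 'b) \<Rightarrow> nat \<Rightarrow> 'b" where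
  "join q f g i = (if i < q then f i else g (i - q))"

lemma join: "i < q \<Longrightarrow> join q f g i = f i" "join q f g (q + i) = g i"
  by (simp_all add: join_def)

text \<open>The systems share the variables \<open>x\<close> but keep separate auxiliary variables:
  rows are stacked, and the coefficient matrices of \<open>y\<close> become block diagonal, the
  second block of variables being shifted by \<open>k\<close>.\<close>

lemma formulation_Int:
  assumes "formulation I S m" "formulation I T n"
  shows "formulation I (S \<inter> T) (m + n)"
proof -
  obtain k p A B b C D d where S: "S = {x. \<exists>y :: nat \<Rightarrow> real.
      (\<forall>i<m. (\<Sum>e\<in>I. A i e * x e) + (\<Sum>j<k::nat. B i j * y j) \<le> b i) \<and>
      (\<forall>i<p::nat. (\<Sum>e\<in>I. C i e * x e) + (\<Sum>j<k. D i j * y j) = d i)}"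
    using assms(1) unfolding formulation_def by blast
  obtain k' p' A' B' b' C' D' d' where T: "T = {x. \<exists>y :: nat \<Rightarrow> real.
      (\<forall>i<n. (\<Sum>e\<in>I. A' i e * x e) + (\<Sum>j<k'::nat. B' i j * y j) \<le> b' i) \<and>
      (\<forall>i<p'::nat. (\<Sum>e\<in>I. C' i e * x e) + (\<Sum>j<k'. D' i j * y j) = d' i)}"
    using assms(2) unfolding formulation_def by blast
  let ?A = "join m A A'" and ?b = "join m b b'" and ?C = "join p C C'" and ?d = "join p d d'"
  let ?B = "join m (\<lambda>i. join k (B i) (\<lambda>_. 0)) (\<lambda>i. join k (\<lambda>_. 0) (B' i))"
  let ?D = "join p (\<lambda>i. join k (D i) (\<lambda>_. 0)) (\<lambda>i. join k (\<lambda>_. 0) (D' i))"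
  have ex: "(\<exists>y. Q y) \<and> (\<exists>y'. Q' y') \<longleftrightarrow> (\<exists>y. Q y \<and> Q' (\<lambda>j. y (k + j)))"
    if Q: "\<And>y y'. (\<And>j. j < k \<Longrightarrow> y j = y' j) \<Longrightarrow> Q y \<longleftrightarrow> Q y'"
    for Q Q' :: "(nat \<Rightarrow> real) \<Rightarrow> bool"
  proof
    assume "(\<exists>y. Q y) \<and> (\<exists>y'. Q' y')"
    then obtain y y' where "Q y" "Q' y'" by blast
    then have "Q (join k y y')" "Q' (\<lambda>j. join k y y' (k + j))"
      using Q[of y "join k y y'"] by (simp_all add: join)
    then show "\<exists>y. Q y \<and> Q' (\<lambda>j. y (k + j))" by blast
  qed blast
  have "S \<inter> T = {x. \<exists>y :: nat \<Rightarrow> real.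
      (\<forall>i<m + n. (\<Sum>e\<in>I. ?A i e * x e) + (\<Sum>j<k + k'. ?B i j * y j) \<le> ?b i) \<and>
      (\<forall>i<p + p'. (\<Sum>e\<in>I. ?C i e * x e) + (\<Sum>j<k + k'. ?D i j * y j) = ?d i)}"
    unfolding S T Int_def mem_Collect_eq
    by (subst ex) (auto simp: all_less_add sum_lessThan_add join intro!: Collect_cong ex_cong1)
  then show ?thesis by (rule formulationI)
qed

lemma formulation_INT:
  assumes "finite X" "\<And>r. r \<in> X \<Longrightarrow> formulation I (S r) m"
  shows "formulation I (\<Inter>r\<in>X. S r) (card X * m)"
  using assms
proof (induction X rule: finite_induct)
  case empty
  show ?case by (simp add: formulation_UNIV)
next
  case (insert r X)
  then show ?case using formulation_Int[of I "S r" m "\<Inter>r\<in>X. S r" "card X * m"] by simp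
qed

text \<open>Coefficients outside \<open>I\<close> are padded with 0. This lets systems found for
  subgraphs be intersected over the edge set of the whole graph.\<close>

lemma formulation_mono:
  assumes "formulation I S m" "I \<subseteq> I'" "finite I'"
  shows "formulation I' S m"
proof -
  obtain k p A B b C D d where S: "S = {x. \<exists>y :: nat \<Rightarrow> real.
      (\<forall>i<m. (\<Sum>e\<in>I. A i e * x e) + (\<Sum>j<k::nat. B i j * y j) \<le> b i) \<and>
      (\<forall>i<p::nat. (\<Sum>e\<in>I. C i e * x e) + (\<Sum>j<k. D i j * y j) = d i)}"
    using assms(1) unfolding formulation_def by blast
  have ext: "(\<Sum>e\<in>I. F e * x e) = (\<Sum>e\<in>I'. (if e \<in> I then F e else 0) * x e)"
    for F x :: "'a \<Rightarrow> real"
    using assms(2,3) by (intro sum.mono_neutral_cong_left) auto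
  show ?thesis
    unfolding S ext by (rule formulationI[OF refl])
qed

section \<open>Polyhedra\<close>

text \<open>The ratio test of the simplex method: the step length is the minimum of
  \<open>s k / \<rho> k\<close> over the constraints with \<open>0 < \<rho> k\<close>. It is
  positive because constraints with \<open>s k = 0\<close> have rate 0.\<close>

lemma exists_tight_step:
  fixes s \<rho> :: "'k \<Rightarrow> real"
  assumes "finite K" and s: "\<And>k. k \<in> K \<Longrightarrow> 0 \<le> s k"
    and tight: "\<And>k. k \<in> K \<Longrightarrow> s k = 0 \<Longrightarrow> \<rho> k = 0"
    and ex: "\<exists>k\<in>K. 0 < \<rho> k"
  shows "\<exists>t>0. (\<forall>k\<in>K. t * \<rho> k \<le> s k) \<and> (\<exists>k\<in>K. s k \<noteq> 0 \<and> t * \<rho> k = s k)"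
proof -
  define R where "R = (\<lambda>k. s k / \<rho> k) ` {k\<in>K. 0 < \<rho> k}"
  have R: "finite R" "R \<noteq> {}" using assms(1) ex by (auto simp: R_def)
  obtain k where k: "k \<in> K" "0 < \<rho> k" "Min R = s k / \<rho> k"
    using Min_in[OF R] by (auto simp: R_def)
  have sk: "s k \<noteq> 0" using tight k by force
  have pos: "0 < Min R" using s[OF k(1)] sk k by simp
  have "Min R * \<rho> l \<le> s l" if l: "l \<in> K" for l
  proof (cases "0 < \<rho> l")
    case True
    then have "Min R \<le> s l / \<rho> l" using l R by (auto simp: R_def)
    then show ?thesis using True by (simp add: field_simps)
  next
    case False
    then have "Min R * \<rho> l \<le> 0" using pos by (simp add: mult_nonneg_nonpos)
    then show ?thesis using s[OF l] by linarith
  qed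
  then show ?thesis using pos k sk by (intro exI[of _ "Min R"]) auto
qed

text \<open>
  Walking from \<open>x\<close> in the directions \<open>v\<close> and \<open>-v\<close> until a new constraint becomes tight
  writes \<open>x\<close> as a convex combination of two points in smaller faces.
\<close>

lemma polyhedron_in_convex:
  fixes slack :: "'v::real_vector \<Rightarrow> 'k \<Rightarrow> real"
  assumes "finite K" "subspace L" "convex C"
    and affine: "\<And>x v t k. k \<in> K \<Longrightarrow> slack (x + t *\<^sub>R v) k = slack x k - t * rate v k"
    and dir: "\<And>x. x \<in> L \<Longrightarrow> \<forall>k\<in>K. 0 \<le> slack x k \<Longrightarrow> x \<notin> C \<Longrightarrow>
      \<exists>v\<in>L. (\<forall>k\<in>K. slack x k = 0 \<longrightarrow> rate v k = 0) \<and> (\<exists>k\<in>K. 0 < rate v k) \<and> (\<exists>k\<in>K. rate v k < 0)"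
    and "x \<in> L" "\<forall>k\<in>K. 0 \<le> slack x k"
  shows "x \<in> C"
  using assms(6,7)
\<comment> \<open>The measure counts the constraints that are not tight. Tight ones have rate 0 and
  stay tight along \<open>v\<close>, so each step to a new tight constraint decreases it.\<close>
proof (induction "card {k\<in>K. slack x k \<noteq> 0}" arbitrary: x rule: less_induct)
  case less
  show ?case
  proof (rule ccontr)
    assume "x \<notin> C"
    then obtain v where v: "v \<in> L" "\<And>k. k \<in> K \<Longrightarrow> slack x k = 0 \<Longrightarrow> rate v k = 0"
        "\<exists>k\<in>K. 0 < rate v k" "\<exists>k\<in>K. rate v k < 0"
      using dir[OF less.prems \<open>x \<notin> C\<close>] by blast
    have face: "x + t *\<^sub>R v \<in> C"
      if le: "\<forall>k\<in>K. t * rate v k \<le> slack x k" and eq: "\<exists>k\<in>K. slack x k \<noteq> 0 \<and> t * rate v k = slack x k"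
      for t
    proof (rule less.hyps)
      have "{k\<in>K. slack (x + t *\<^sub>R v) k \<noteq> 0} \<subset> {k\<in>K. slack x k \<noteq> 0}"
      proof
        show "{k\<in>K. slack (x + t *\<^sub>R v) k \<noteq> 0} \<subseteq> {k\<in>K. slack x k \<noteq> 0}"
          using v(2) by (auto simp: affine)
        obtain k where k: "k \<in> K" "slack x k \<noteq> 0" "t * rate v k = slack x k"
          using eq by blast
        then have "slack (x + t *\<^sub>R v) k = 0" using affine[of k x t v] by simp
        then show "{k\<in>K. slack (x + t *\<^sub>R v) k \<noteq> 0} \<noteq> {k\<in>K. slack x k \<noteq> 0}"
          using k by blast
      qed
      then show "card {k\<in>K. slack (x + t *\<^sub>R v) k \<noteq> 0} < card {k\<in>K. slack x k \<noteq> 0}"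
        using assms(1) by (intro psubset_card_mono) auto
      show "x + t *\<^sub>R v \<in> L"
        using \<open>subspace L\<close> v(1) less.prems by (simp add: subspace_add subspace_scale)
      show "\<forall>k\<in>K. 0 \<le> slack (x + t *\<^sub>R v) k"
        using le by (simp add: affine)
    qed
    obtain t where t: "t > 0" "x + t *\<^sub>R v \<in> C"
    proof -
      have "\<exists>t>0. (\<forall>k\<in>K. t * rate v k \<le> slack x k) \<and> (\<exists>k\<in>K. slack x k \<noteq> 0 \<and> t * rate v k = slack x k)"
        using v less.prems assms(1) by (intro exists_tight_step) auto
      then show ?thesis using face that by blast
    qed
    obtain u where u: "u > 0" "x + (-u) *\<^sub>R v \<in> C"
    proof -
      have "\<exists>u>0. (\<forall>k\<in>K. u * - rate v k \<le> slack x k) \<and> (\<exists>k\<in>K. slack x k \<noteq> 0 \<and> u * - rate v k = slack x k)"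
        using v less.prems assms(1) by (intro exists_tight_step) auto
      then obtain u where "u > 0" "\<forall>k\<in>K. (-u) * rate v k \<le> slack x k"
          "\<exists>k\<in>K. slack x k \<noteq> 0 \<and> (-u) * rate v k = slack x k"
        by auto
      then show ?thesis using face[of "-u"] that by blast
    qed
    \<comment> \<open>The weights are inversely proportional to the step lengths \<open>t\<close>
      and \<open>u\<close>, so that \<open>v\<close> cancels.\<close>
    have "(u / (t + u)) *\<^sub>R (x + t *\<^sub>R v) + (t / (t + u)) *\<^sub>R (x + (-u) *\<^sub>R v) \<in> C"
      using t u \<open>convex C\<close> by (intro convexD) (simp_all add: add_divide_distrib[symmetric] add.commute)
    also have "(u / (t + u)) *\<^sub>R (x + t *\<^sub>R v) + (t / (t + u)) *\<^sub>R (x + (-u) *\<^sub>R v)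
        = (u / (t + u) + t / (t + u)) *\<^sub>R x"
      by (simp add: algebra_simps)
    also have "u / (t + u) + t / (t + u) = 1"
      using t(1) u(1) by (simp add: add_divide_distrib[symmetric] add.commute)
    finally show False using \<open>x \<notin> C\<close> by simp
  qed
qed

section \<open>Forests\<close>

lemma simple_graph_finite_edges: "simple_graph G \<Longrightarrow> finite (edges G)"
  by (rule finite_subset[of _ "Pow (verts G)"]) (auto simp: simple_graph_def)

lemma simple_graph_edgeE:
  assumes "simple_graph G" "e \<in> edges G" "a \<in> e"
  obtains b where "e = {a, b}" "a \<noteq> b"
proof -
  obtain u w where "e = {u, w}" "u \<noteq> w"
    using assms(1,2) unfolding simple_graph_def by (metis card_2_iff)
  then show ?thesis using that[of u] that[of w] assms(3) by auto
qed

text \<open>The first vertex of a longest path is a leaf: a further neighbour off the path would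
  extend it, and one on the path would close a prefix to a cycle. Reversing the path gives a second
  leaf, and one of the two differs from \<open>r\<close>.\<close>

lemma forest_leaf:
  assumes "forest G" "edges G \<noteq> {}"
  obtains v e where "v \<noteq> r" "{e'\<in>edges G. v \<in> e'} = {e}"
proof -
  have G: "simple_graph G" and acyc: "\<And>vs. \<not> is_cycle G vs"
    using assms(1) by (auto simp: forest_def)
  have fin: "finite (verts G)" using G by (simp add: simple_graph_def)
  define path where "path vs \<longleftrightarrow> distinct vs \<and> successively (\<lambda>u v. {u, v} \<in> edges G) vs
    \<and> set vs \<subseteq> verts G \<and> 2 \<le> length vs" for vs
  obtain e where e: "e \<in> edges G" using assms(2) by blast
  then obtain a b where ab: "e = {a, b}" "a \<noteq> b"
    using G unfolding simple_graph_def by (metis card_2_iff)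
  have "path [a, b]" using e ab G by (auto simp: path_def simple_graph_def)
  moreover have "\<forall>vs. path vs \<longrightarrow> length vs < Suc (card (verts G))"
    using fin by (metis card_mono distinct_card less_Suc_eq_le path_def)
  ultimately obtain vs where vs: "path vs" and longest: "\<And>ws. path ws \<Longrightarrow> length ws \<le> length vs"
    using ex_has_greatest_nat[of path "[a, b]" length "Suc (card (verts G))"] by blast
  have leaf: "{e'\<in>edges G. hd ws \<in> e'} = {{hd ws, ws ! 1}}"
    if ws: "path ws" "length ws = length vs" for ws
  proof -
    have len: "2 \<le> length ws" using ws by (simp add: path_def)
    then have hd: "hd ws = ws ! 0" by (metis hd_conv_nth list.size(3) not_numeral_le_zero)
    have adj: "{ws ! i, ws ! Suc i} \<in> edges G" if "Suc i < length ws" for i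
      using that ws(1) by (simp add: path_def successively_conv_nth)
    have "e' = {hd ws, ws ! 1}" if e': "e' \<in> edges G" "hd ws \<in> e'" for e'
    proof -
      obtain z where z: "e' = {hd ws, z}" "hd ws \<noteq> z"
        using simple_graph_edgeE[OF G e'] by metis
      have zV: "z \<in> verts G" using z e' G by (auto simp: simple_graph_def)
      have "z \<in> set ws"
      proof (rule ccontr)
        assume "z \<notin> set ws"
        then have "path (z # ws)"
          using ws(1) zV e' z by (auto simp: path_def successively_Cons insert_commute)
        then show False using longest[of "z # ws"] ws(2) by simp
      qed
      then obtain j where j: "j < length ws" "ws ! j = z" by (auto simp: in_set_conv_nth)
      have "j \<noteq> 0" using j z hd by metis
      moreover have "\<not> 2 \<le> j"
      proof
        assume j2: "2 \<le> j"
        have "{take (Suc j) ws ! i, take (Suc j) ws ! (Suc i mod Suc j)} \<in> edges G" if "i < Suc j" for i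
        proof (cases "i = j")
          case True
          then show ?thesis using j e' z hd by (simp add: insert_commute)
        next
          case False
          then show ?thesis using that adj[of i] j by simp
        qed
        then have "is_cycle G (take (Suc j) ws)"
          using j j2 ws(1) by (simp add: is_cycle_def path_def)
        then show False using acyc by blast
      qed
      ultimately have "j = 1" by linarith
      then show ?thesis using z j by simp
    qed
    moreover have "{hd ws, ws ! 1} \<in> edges G" using adj[of 0] len hd by simp
    ultimately show ?thesis by blast
  qed
  have rev: "path (rev vs)" using vs by (simp add: path_def insert_commute)
  have "hd vs \<noteq> hd (rev vs)"
  proof -
    have "2 \<le> length vs" "distinct vs" using vs by (simp_all add: path_def)
    then show ?thesis by (cases vs) (auto simp: hd_append hd_rev)
  qed
  then show ?thesis using that leaf[OF vs] leaf[OF rev] by (metis length_rev)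
qed

text \<open>Orienting a forest away from \<open>r\<close> assigns to each edge its head.\<close>

lemma forest_heads:
  assumes "forest G"
  shows "\<exists>h. inj_on h (edges G) \<and> (\<forall>e\<in>edges G. h e \<in> e \<and> h e \<noteq> r)"
  using assms
proof (induction "card (edges G)" arbitrary: G rule: less_induct)
  case less
  show ?case
  proof (cases "edges G = {}")
    case False
    obtain v e where v: "v \<noteq> r" "{e'\<in>edges G. v \<in> e'} = {e}"
      using forest_leaf[OF less.prems False] by metis
    have G: "simple_graph G" using less.prems by (simp add: forest_def)
    define H where "H = G\<lparr>edges := edges G - {e}\<rparr>"
    have "forest H" using less.prems by (auto simp: H_def forest_def simple_graph_def is_cycle_def)
    moreover have "card (edges H) < card (edges G)"
      using v simple_graph_finite_edges[OF G] by (auto simp: H_def intro!: psubset_card_mono)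
    ultimately obtain h where h: "inj_on h (edges H)" "\<forall>e\<in>edges H. h e \<in> e \<and> h e \<noteq> r"
      using less.hyps by blast
    \<comment> \<open>Only \<open>e\<close> contains the leaf \<open>v\<close>, so no edge of
      \<open>H\<close> has head \<open>v\<close>.\<close>
    have "inj_on (h(e := v)) (insert e (edges H))"
      using h v by (auto simp: inj_on_def H_def)
    moreover have "insert e (edges H) = edges G" using v by (auto simp: H_def)
    moreover have "\<forall>e'\<in>edges G. (h(e := v)) e' \<in> e' \<and> (h(e := v)) e' \<noteq> r"
      using h v by (auto simp: H_def)
    ultimately show ?thesis by metis
  qed simp
qed

text \<open>Provides the violated constraint for a cycle: the vertex set of the cycle spans at least
  as many edges as it has vertices.\<close>

lemma cycle_edges:
  assumes "is_cycle G vs"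
  shows "\<exists>F\<subseteq>edges G. finite F \<and> \<Union>F \<subseteq> set vs \<and> card F = card (set vs)"
proof -
  let ?n = "length vs"
  let ?e = "\<lambda>i. {vs ! i, vs ! (Suc i mod ?n)}"
  have n: "3 \<le> ?n" "distinct vs" using assms by (auto simp: is_cycle_def)
  have less: "Suc i mod ?n < ?n" for i using n(1) by (intro mod_less_divisor) linarith
  have "inj_on ?e {..<?n}"
  proof (rule inj_onI)
    fix i j assume i: "i \<in> {..<?n}" and j: "j \<in> {..<?n}" and eq: "?e i = ?e j"
    show "i = j"
    proof (rule ccontr)
      assume "i \<noteq> j"
      then have "vs ! i \<noteq> vs ! j" using i j n nth_eq_iff_index_eq by fastforce
      \<comment> \<open>Equal pairs with different first entries match crosswise, so
        \<open>i\<close> and \<open>j\<close> would be cyclic successors of each other, which is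
        impossible for length at least 3.\<close>
      then have "vs ! i = vs ! (Suc j mod ?n)" "vs ! j = vs ! (Suc i mod ?n)"
        using eq by (auto simp: doubleton_eq_iff)
      then have "i = Suc j mod ?n" "j = Suc i mod ?n"
        using i j n less nth_eq_iff_index_eq by (metis lessThan_iff)+
      moreover have "Suc k mod ?n = (if Suc k = ?n then 0 else Suc k)" if "k < ?n" for k
        using that by (simp add: mod_Suc)
      ultimately show False using i j n(1) by (auto split: if_splits)
    qed
  qed
  then have "card (?e ` {..<?n}) = card (set vs)"
    using n by (simp add: card_image distinct_card)
  moreover have "?e ` {..<?n} \<subseteq> edges G" using assms by (auto simp: is_cycle_def)
  moreover have "\<Union>(?e ` {..<?n}) \<subseteq> set vs" using less by auto
  ultimately show ?thesis by (intro exI[of _ "?e ` {..<?n}"]) simp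
qed

section \<open>The forest polytope\<close>

definition edges_in :: "'a ugraph \<Rightarrow> 'a set \<Rightarrow> 'a set set" where
  "edges_in G U = {e \<in> edges G. e \<subseteq> U}"

text \<open>Total functions, unrestricted off the edges, put the sets belonging to different
  subgraphs into one space, where they can be intersected directly.\<close>

definition forest_ineqs :: "'a ugraph \<Rightarrow> ('a set \<Rightarrow> real) set" where
  "forest_ineqs G = {x. (\<forall>e\<in>edges G. 0 \<le> x e) \<and>
     (\<forall>U. U \<subseteq> verts G \<and> U \<noteq> {} \<longrightarrow> sum x (edges_in G U) \<le> real (card U) - 1)}"

lemma forest_ineqsD:
  assumes "x \<in> forest_ineqs G"
  shows "e \<in> edges G \<Longrightarrow> 0 \<le> x e"
    and "U \<subseteq> verts G \<Longrightarrow> U \<noteq> {} \<Longrightarrow> sum x (edges_in G U) \<le> real (card U) - 1"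
  using assms unfolding forest_ineqs_def by blast+

text \<open>
  Here \<open>y (e, v)\<close> is the part of the weight \<open>x e\<close> that is oriented towards the end \<open>v\<close> of \<open>e\<close>.
\<close>

definition orientable :: "'a ugraph \<Rightarrow> 'a \<Rightarrow> ('a set \<Rightarrow> real) set" where
  "orientable G r = {x. \<exists>y.
     (\<forall>e\<in>edges G. \<forall>v\<in>e. 0 \<le> y (e, v)) \<and>
     (\<forall>v\<in>verts G. (\<Sum>e | e \<in> edges G \<and> v \<in> e. y (e, v)) \<le> (if v = r then 0 else 1)) \<and>
     (\<forall>e\<in>edges G. (\<Sum>v\<in>e. y (e, v)) = x e)}"

lemma lookup_scaleR: "Poly_Mapping.lookup (c *\<^sub>R x) i = c * Poly_Mapping.lookup x i"
  for x :: "'i \<Rightarrow>\<^sub>0 real"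
proof -
  have "finite {i. c * Poly_Mapping.lookup x i \<noteq> 0}"
    by (rule finite_subset[OF _ finite_keys[of x]]) (auto simp: in_keys_iff)
  then show ?thesis by (simp add: scaleR_poly_mapping_def)
qed

lemma orientable_nonneg:
  assumes "x \<in> orientable G r" "e \<in> edges G"
  shows "0 \<le> x e"
proof -
  obtain y where y: "\<forall>e\<in>edges G. \<forall>v\<in>e. 0 \<le> y (e, v)" "\<forall>e\<in>edges G. (\<Sum>v\<in>e. y (e, v)) = x e"
    using assms(1) unfolding orientable_def by blast
  have "0 \<le> (\<Sum>v\<in>e. y (e, v))" using y(1) assms(2) by (intro sum_nonneg) blast
  then show ?thesis using y(2) assms(2) by simp
qed

text \<open>Double counting: an edge inside \<open>U\<close> gives all its weight to vertices of
  \<open>U\<close>, and of these \<open>r\<close> receives nothing and the others at most 1 each.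
  Edges leaving \<open>U\<close> only add to what a vertex receives.\<close>

lemma orientable_sum_le:
  assumes G: "simple_graph G" and x: "x \<in> orientable G r" and U: "U \<subseteq> verts G" "r \<in> U"
  shows "sum x (edges_in G U) \<le> real (card U) - 1"
proof -
  obtain y where y: "\<And>e v. e \<in> edges G \<Longrightarrow> v \<in> e \<Longrightarrow> 0 \<le> y (e, v)"
      "\<And>v. v \<in> verts G \<Longrightarrow> (\<Sum>e | e \<in> edges G \<and> v \<in> e. y (e, v)) \<le> (if v = r then 0 else 1)"
      "\<And>e. e \<in> edges G \<Longrightarrow> (\<Sum>v\<in>e. y (e, v)) = x e"
    using x unfolding orientable_def by blast
  have finE: "finite (edges G)" using G by (rule simple_graph_finite_edges)
  have finU: "finite U" using G U by (meson finite_subset simple_graph_def)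
  have "sum x (edges_in G U) = (\<Sum>e\<in>edges_in G U. \<Sum>v\<in>{v\<in>U. v \<in> e}. y (e, v))"
  proof (rule sum.cong)
    fix e assume "e \<in> edges_in G U"
    moreover from this have "{v\<in>U. v \<in> e} = e" by (auto simp: edges_in_def)
    ultimately show "x e = (\<Sum>v\<in>{v\<in>U. v \<in> e}. y (e, v))" using y(3) by (simp add: edges_in_def)
  qed simp
  also have "\<dots> = (\<Sum>v\<in>U. \<Sum>e\<in>{e\<in>edges_in G U. v \<in> e}. y (e, v))"
    using finE finU by (intro sum.swap_restrict) (simp_all add: edges_in_def)
  also have "\<dots> \<le> (\<Sum>v\<in>U. if v = r then 0 else 1)"
  proof (rule sum_mono)
    fix v assume "v \<in> U"
    have "(\<Sum>e\<in>{e\<in>edges_in G U. v \<in> e}. y (e, v)) \<le> (\<Sum>e | e \<in> edges G \<and> v \<in> e. y (e, v))"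
      using finE y(1) by (intro sum_mono2) (auto simp: edges_in_def)
    also have "\<dots> \<le> (if v = r then 0 else 1)" using y(2) \<open>v \<in> U\<close> U by blast
    finally show "(\<Sum>e\<in>{e\<in>edges_in G U. v \<in> e}. y (e, v)) \<le> (if v = r then 0 else 1)" .
  qed
  also have "\<dots> = real (card (U - {r}))"
    using finU by (simp add: sum.If_cases Collect_neg_eq[symmetric] Diff_eq)
  also have "\<dots> = real (card U) - 1"
    using finU U by (simp add: card_Diff_singleton card_gt_0_iff of_nat_diff Suc_le_eq)
      (metis One_nat_def Suc_leI card_gt_0_iff empty_iff of_nat_1 of_nat_diff)
  finally show ?thesis .
qed

lemma forest_orientable:
  assumes G: "simple_graph G" and F: "subgraph F G" "forest F"
  shows "Poly_Mapping.lookup (char_vec (edges F)) \<in> orientable G r"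
proof -
  obtain h where h: "inj_on h (edges F)" "\<And>e. e \<in> edges F \<Longrightarrow> h e \<in> e \<and> h e \<noteq> r"
    using forest_heads[OF F(2), of r] by blast
  have finF: "finite (edges F)" using F(2) by (simp add: forest_def simple_graph_finite_edges)
  have finE: "finite (edges G)" using G by (rule simple_graph_finite_edges)
  \<comment> \<open>Each forest edge gives its unit weight to its head. Injectivity of
    \<open>h\<close> bounds what a vertex receives by 1, and no head is \<open>r\<close>.\<close>
  define y where "y = (\<lambda>(e, v). if e \<in> edges F \<and> v = h e then 1 else 0 :: real)"
  have "(\<Sum>e | e \<in> edges G \<and> v \<in> e. y (e, v)) \<le> (if v = r then 0 else 1)" for v
  proof (cases "v \<in> h ` edges F")
    case True
    then obtain e\<^sub>0 where e\<^sub>0: "e\<^sub>0 \<in> edges F" "v = h e\<^sub>0" by blast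
    have "(\<Sum>e | e \<in> edges G \<and> v \<in> e. y (e, v))
        \<le> (\<Sum>e | e \<in> edges G \<and> v \<in> e. if e = e\<^sub>0 then 1 else 0)"
      using e\<^sub>0 h(1) by (intro sum_mono) (auto simp: y_def dest: inj_onD)
    also have "\<dots> \<le> 1" using finE by simp
    finally show ?thesis using e\<^sub>0 h(2) by simp
  next
    case False
    then have "(\<Sum>e | e \<in> edges G \<and> v \<in> e. y (e, v)) = 0"
      by (intro sum.neutral) (auto simp: y_def)
    then show ?thesis by simp
  qed
  moreover have "(\<Sum>v\<in>e. y (e, v)) = Poly_Mapping.lookup (char_vec (edges F)) e" if "e \<in> edges G" for e
  proof -
    have "finite e" using that G by (metis card.infinite simple_graph_def zero_neq_numeral)
    then show ?thesis using h(2)[of e] by (simp add: y_def lookup_char_vec finF)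
  qed
  ultimately show ?thesis
    unfolding orientable_def by (intro CollectI exI[of _ y]) (auto simp: y_def)
qed

text \<open>Convex combinations of the splittings \<open>y\<close> split the combined point; this
  carries orientability from the forests to their hull.\<close>

lemma convex_orientable: "convex {x. Poly_Mapping.lookup x \<in> orientable G r}"
proof (rule convexI)
  fix x\<^sub>1 x\<^sub>2 and a b :: real
  assume ab: "0 \<le> a" "0 \<le> b" "a + b = 1"
  assume "x\<^sub>1 \<in> {x. Poly_Mapping.lookup x \<in> orientable G r}" "x\<^sub>2 \<in> {x. Poly_Mapping.lookup x \<in> orientable G r}"
  then have "Poly_Mapping.lookup x\<^sub>1 \<in> orientable G r" "Poly_Mapping.lookup x\<^sub>2 \<in> orientable G r"
    by simp_all
  then obtain y\<^sub>1 y\<^sub>2 where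
    y: "\<forall>e\<in>edges G. \<forall>v\<in>e. 0 \<le> y\<^sub>1 (e, v)" "\<forall>e\<in>edges G. \<forall>v\<in>e. 0 \<le> y\<^sub>2 (e, v)"
      "\<forall>v\<in>verts G. (\<Sum>e | e \<in> edges G \<and> v \<in> e. y\<^sub>1 (e, v)) \<le> (if v = r then 0 else 1)"
      "\<forall>v\<in>verts G. (\<Sum>e | e \<in> edges G \<and> v \<in> e. y\<^sub>2 (e, v)) \<le> (if v = r then 0 else 1)"
      "\<forall>e\<in>edges G. (\<Sum>v\<in>e. y\<^sub>1 (e, v)) = Poly_Mapping.lookup x\<^sub>1 e"
      "\<forall>e\<in>edges G. (\<Sum>v\<in>e. y\<^sub>2 (e, v)) = Poly_Mapping.lookup x\<^sub>2 e"
    unfolding orientable_def mem_Collect_eq by (elim exE conjE) (rule that)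
  let ?y = "\<lambda>p. a * y\<^sub>1 p + b * y\<^sub>2 p"
  have "(\<Sum>e | e \<in> edges G \<and> v \<in> e. ?y (e, v)) \<le> (if v = r then 0 else 1)" if "v \<in> verts G" for v
  proof -
    have "(\<Sum>e | e \<in> edges G \<and> v \<in> e. ?y (e, v))
        = a * (\<Sum>e | e \<in> edges G \<and> v \<in> e. y\<^sub>1 (e, v)) + b * (\<Sum>e | e \<in> edges G \<and> v \<in> e. y\<^sub>2 (e, v))"
      by (simp add: sum.distrib sum_distrib_left)
    also have "\<dots> \<le> a * (if v = r then 0 else 1) + b * (if v = r then 0 else 1)"
      using y(3,4) that ab(1,2) by (intro add_mono mult_left_mono) blast+
    finally show ?thesis using ab by (simp split: if_splits)
  qed
  moreover have "(\<Sum>v\<in>e. ?y (e, v)) = Poly_Mapping.lookup (a *\<^sub>R x\<^sub>1 + b *\<^sub>R x\<^sub>2) e" if "e \<in> edges G" for e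
    using y(5,6) that by (simp add: lookup_add lookup_scaleR sum.distrib sum_distrib_left[symmetric])
  ultimately show "a *\<^sub>R x\<^sub>1 + b *\<^sub>R x\<^sub>2 \<in> {x. Poly_Mapping.lookup x \<in> orientable G r}"
    unfolding orientable_def using ab y(1,2) by (intro CollectI exI[of _ ?y]) auto
qed

lemma forest_polytope_orientable:
  assumes "simple_graph G" "x \<in> forest_polytope G"
  shows "Poly_Mapping.lookup x \<in> orientable G r"
proof -
  have "forest_polytope G \<subseteq> {x. Poly_Mapping.lookup x \<in> orientable G r}"
    unfolding forest_polytope_def
    using forest_orientable[OF assms(1)] by (intro hull_minimal convex_orientable) auto
  then show ?thesis using assms(2) by blast
qed

lemma subspace_keys: "subspace {x :: 'i \<Rightarrow>\<^sub>0 real. Poly_Mapping.keys x \<subseteq> I}"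
  unfolding subspace_def
proof (intro conjI ballI allI CollectI)
  show "Poly_Mapping.keys (x + y) \<subseteq> I"
    if "x \<in> {x. Poly_Mapping.keys x \<subseteq> I}" "y \<in> {x. Poly_Mapping.keys x \<subseteq> I}" for x y :: "'i \<Rightarrow>\<^sub>0 real"
    using that Poly_Mapping.keys_add[of x y] by blast
qed (auto simp: in_keys_iff lookup_scaleR)

lemma forest_polytope_keys:
  assumes "x \<in> forest_polytope G"
  shows "Poly_Mapping.keys x \<subseteq> edges G"
proof -
  have "forest_polytope G \<subseteq> {x. Poly_Mapping.keys x \<subseteq> edges G}"
    unfolding forest_polytope_def
    by (intro hull_minimal subspace_imp_convex subspace_keys)
      (auto simp: in_keys_iff lookup_char_vec forest_def subgraph_def simple_graph_finite_edges split: if_splits)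
  then show ?thesis using assms by blast
qed

section \<open>Edmonds' theorem: integrality of the forest inequalities\<close>

text \<open>A cycle among the edges of value 1 would give its vertex set \<open>U\<close> a weight
  of at least \<open>card U\<close>.\<close>

lemma forest_ineqs_integral:
  assumes G: "simple_graph G" and x: "Poly_Mapping.keys x \<subseteq> edges G" "Poly_Mapping.lookup x \<in> forest_ineqs G"
    and int: "\<forall>e\<in>edges G. Poly_Mapping.lookup x e \<in> {0, 1}"
  shows "x \<in> forest_polytope G"
proof -
  define F where "F = G\<lparr>edges := {e\<in>edges G. Poly_Mapping.lookup x e = 1}\<rparr>"
  have F: "simple_graph F" "subgraph F G"
    using G by (auto simp: F_def simple_graph_def subgraph_def)
  have finE: "finite (edges G)" using G by (rule simple_graph_finite_edges)
  have "\<not> is_cycle F vs" for vs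
  proof
    assume "is_cycle F vs"
    then obtain E where E: "E \<subseteq> edges F" "\<Union>E \<subseteq> set vs" "card E = card (set vs)" and "3 \<le> length vs"
      using cycle_edges[of F vs] by (auto simp: is_cycle_def)
    have V: "set vs \<subseteq> verts G"
    proof
      fix v assume "v \<in> set vs"
      then obtain i where "i < length vs" "v = vs ! i" by (auto simp: in_set_conv_nth)
      then show "v \<in> verts G" using \<open>is_cycle F vs\<close> F by (auto simp: is_cycle_def simple_graph_def F_def)
    qed
    have "real (card (set vs)) = (\<Sum>e\<in>E. Poly_Mapping.lookup x e)"
      using E by (subst sum.cong[OF refl, of _ _ "\<lambda>_. 1"]) (auto simp: F_def)
    also have "\<dots> \<le> sum (Poly_Mapping.lookup x) (edges_in G (set vs))"
      using finE E x(2) by (intro sum_mono2) (auto simp: edges_in_def F_def forest_ineqs_def)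
    also have "\<dots> \<le> real (card (set vs)) - 1"
      using V \<open>3 \<le> length vs\<close> by (intro forest_ineqsD(2)[OF x(2)]) auto
    finally show False by simp
  qed
  then have "forest F" using F by (simp add: forest_def)
  moreover have "x = char_vec (edges F)"
    using x(1) int finE
    by (intro poly_mapping_eqI) (auto simp: F_def lookup_char_vec in_keys_iff)
  ultimately show ?thesis
    unfolding forest_polytope_def using F by (intro hull_inc) blast
qed

text \<open>Uncrossing: \<open>x \<ge> 0\<close> makes \<open>sum x (edges_in G U)\<close>
  supermodular in \<open>U\<close>, while \<open>card\<close> is modular, so the constraints of
  \<open>U \<union> W\<close> and \<open>U \<inter> W\<close> are both forced to equality. A
  constraint for \<open>U \<inter> W\<close> exists only if it is nonempty.\<close>

lemma tight_Int:
  assumes G: "simple_graph G" and x: "x \<in> forest_ineqs G" and UW: "U \<subseteq> verts G" "W \<subseteq> verts G" "U \<inter> W \<noteq> {}"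
    and tight: "sum x (edges_in G U) = real (card U) - 1" "sum x (edges_in G W) = real (card W) - 1"
  shows "sum x (edges_in G (U \<inter> W)) = real (card (U \<inter> W)) - 1"
proof -
  have fin: "finite (edges_in G T)" for T
    using simple_graph_finite_edges[OF G] by (simp add: edges_in_def)
  have finUW: "finite U" "finite W" using G UW by (meson finite_subset simple_graph_def)+
  have "sum x (edges_in G U \<union> edges_in G W) \<le> sum x (edges_in G (U \<union> W))"
    using fin by (intro sum_mono2) (auto simp: edges_in_def intro: forest_ineqsD(1)[OF x])
  also have "\<dots> \<le> real (card (U \<union> W)) - 1"
    using UW by (intro forest_ineqsD(2)[OF x]) auto
  finally have union: "sum x (edges_in G U \<union> edges_in G W) \<le> real (card (U \<union> W)) - 1" .
  have "edges_in G U \<inter> edges_in G W = edges_in G (U \<inter> W)" by (auto simp: edges_in_def)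
  then have "sum x (edges_in G U \<union> edges_in G W) + sum x (edges_in G (U \<inter> W))
      = sum x (edges_in G U) + sum x (edges_in G W)"
    using sum.union_inter[of "edges_in G U" "edges_in G W" x] fin by simp
  moreover have "real (card (U \<union> W)) + real (card (U \<inter> W)) = real (card U) + real (card W)"
    using card_Un_Int[OF finUW] by simp
  moreover have "sum x (edges_in G (U \<inter> W)) \<le> real (card (U \<inter> W)) - 1"
    using UW by (intro forest_ineqsD(2)[OF x]) auto
  ultimately show ?thesis using union tight by linarith
qed

lemma sum_lookup_single:
  assumes "finite A"
  shows "sum (Poly_Mapping.lookup (Poly_Mapping.single a (1::real))) A = (if a \<in> A then 1 else 0)"
  unfolding lookup_single when_def by (rule sum.delta'[OF assms])

text \<open>
  Outside the integral points, the direction is \<open>a\<close> or \<open>a - b\<close> for fractional edges \<open>a\<close>, \<open>b\<close>.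
  For the latter choose a minimal tight set containing a fractional edge: by \<open>tight_Int\<close>, all
  fractional edges in it lie in the same tight sets, and by integrality there are two of them.
\<close>

lemma forest_ineqs_direction:
  assumes G: "simple_graph G" and x: "x \<in> forest_ineqs G" and frac: "\<exists>e\<in>edges G. x e \<notin> {0, 1}"
  shows "\<exists>v :: 'a set \<Rightarrow>\<^sub>0 real. Poly_Mapping.keys v \<subseteq> edges G \<and>
    (\<forall>e\<in>edges G. x e = 0 \<longrightarrow> Poly_Mapping.lookup v e = 0) \<and>
    (\<forall>U. U \<subseteq> verts G \<and> U \<noteq> {} \<and> sum x (edges_in G U) = real (card U) - 1
        \<longrightarrow> sum (Poly_Mapping.lookup v) (edges_in G U) = 0) \<and>
    (\<exists>U. U \<subseteq> verts G \<and> U \<noteq> {} \<and> 0 < sum (Poly_Mapping.lookup v) (edges_in G U)) \<and>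
    (\<exists>e\<in>edges G. 0 < Poly_Mapping.lookup v e)"
proof -
  define tight where "tight U \<longleftrightarrow> U \<subseteq> verts G \<and> sum x (edges_in G U) = real (card U) - 1" for U
  define fractional where "fractional = {e\<in>edges G. x e \<notin> {0, 1}}"
  have fin: "finite (edges_in G T)" for T
    using simple_graph_finite_edges[OF G] by (simp add: edges_in_def)
  \<comment> \<open>The two ends of an edge \<open>e\<close> form a vertex set whose constraint
    involves \<open>x e\<close> alone and says \<open>x e \<le> 1\<close>.\<close>
  have single: "edges_in G e = {e}" "e \<subseteq> verts G" "e \<noteq> {}" if "e \<in> edges G" for e
  proof -
    have "e' = e" if "e' \<in> edges G" "e' \<subseteq> e" for e'
      using that \<open>e \<in> edges G\<close> G unfolding simple_graph_def
      by (metis card.infinite card_subset_eq zero_neq_numeral)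
    then show "edges_in G e = {e}" using that by (auto simp: edges_in_def)
    show "e \<subseteq> verts G" "e \<noteq> {}" using that G by (auto simp: simple_graph_def)
  qed
  have bounds: "0 < x e" "x e < 1" if "e \<in> fractional" for e
  proof -
    have e: "e \<in> edges G" "x e \<noteq> 0" "x e \<noteq> 1" using that by (auto simp: fractional_def)
    have "sum x (edges_in G e) \<le> real (card e) - 1"
      using single(2,3)[OF e(1)] by (rule forest_ineqsD(2)[OF x])
    moreover have "card e = 2" using e(1) G by (simp add: simple_graph_def)
    ultimately show "x e < 1" using single(1)[OF e(1)] e by simp
    show "0 < x e" using forest_ineqsD(1)[OF x e(1)] e(2) by simp
  qed
  show ?thesis
  proof (cases "\<exists>U. tight U \<and> (\<exists>a\<in>fractional. a \<subseteq> U)")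
    case False
    obtain a where a: "a \<in> fractional" using frac by (auto simp: fractional_def)
    then have aE: "a \<in> edges G" by (simp add: fractional_def)
    let ?v = "Poly_Mapping.single a (1::real)"
    have sums: "sum (Poly_Mapping.lookup ?v) (edges_in G U) = (if a \<subseteq> U then 1 else 0)" for U
      using aE sum_lookup_single[OF fin] by (simp add: edges_in_def)
    show ?thesis
    proof (intro exI[of _ ?v] conjI)
      show "\<forall>e\<in>edges G. x e = 0 \<longrightarrow> Poly_Mapping.lookup ?v e = 0"
        using bounds[OF a] by (auto simp: lookup_single when_def)
      show "\<exists>U. U \<subseteq> verts G \<and> U \<noteq> {} \<and> 0 < sum (Poly_Mapping.lookup ?v) (edges_in G U)"
        using single(2,3)[OF aE] sums[of a] by (intro exI[of _ a]) simp
      show "\<forall>U. U \<subseteq> verts G \<and> U \<noteq> {} \<and> sum x (edges_in G U) = real (card U) - 1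
        \<longrightarrow> sum (Poly_Mapping.lookup ?v) (edges_in G U) = 0"
        using False a by (auto simp: sums tight_def)
      show "\<exists>e\<in>edges G. 0 < Poly_Mapping.lookup ?v e" using aE by (intro bexI[of _ a]) auto
    qed (use aE in auto)
  next
    case True
    define Q where "Q U \<longleftrightarrow> tight U \<and> (\<exists>a\<in>fractional. a \<subseteq> U)" for U
    obtain U where U: "Q U" and least: "\<And>W. Q W \<Longrightarrow> card U \<le> card W"
      using True ex_has_least_nat[of Q _ card] unfolding Q_def by metis
    obtain a where a: "a \<in> fractional" "a \<subseteq> U" using U by (auto simp: Q_def)
    then have aE: "a \<in> edges G" by (simp add: fractional_def)
    \<comment> \<open>By uncrossing, \<open>U \<inter> W\<close> is tight and still contains the
      fractional edge \<open>b\<close>, so minimality of \<open>U\<close> forces it to be all of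
      \<open>U\<close>.\<close>
    have same: "U \<subseteq> W" if "tight W" "b \<in> fractional" "b \<subseteq> U" "b \<subseteq> W" for b W
    proof -
      have "b \<noteq> {}" using single(3) that(2) by (auto simp: fractional_def)
      then have "tight (U \<inter> W)"
        using tight_Int[OF G x, of U W] U that by (auto simp: tight_def Q_def)
      then have "card U \<le> card (U \<inter> W)" using least that by (auto simp: Q_def)
      moreover have "finite U"
        using U G unfolding Q_def tight_def by (meson finite_subset simple_graph_def)
      ultimately have "U \<inter> W = U" by (intro card_seteq) auto
      then show ?thesis by blast
    qed
    have "\<exists>b\<in>fractional. b \<noteq> a \<and> b \<subseteq> U"
    proof (rule ccontr)
      assume no: "\<not> ?thesis"
      \<comment> \<open>If \<open>a\<close> were the only fractional edge in \<open>U\<close>, the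
        integral right-hand side of the tight constraint would make \<open>x a\<close> an
        integer.\<close>
      have "sum x (edges_in G U - {a}) \<in> \<int>"
        using no by (intro Ints_sum) (auto simp: edges_in_def fractional_def)
      moreover have "sum x (edges_in G U) = x a + sum x (edges_in G U - {a})"
        using a aE fin by (intro sum.remove) (auto simp: edges_in_def)
      moreover have "sum x (edges_in G U) \<in> \<int>" using U by (simp add: Q_def tight_def)
      ultimately have "x a \<in> \<int>" by (metis Ints_diff add_diff_cancel_right')
      then show False using bounds[OF a(1)] by (auto elim!: Ints_cases)
    qed
    then obtain b where b: "b \<in> fractional" "b \<noteq> a" "b \<subseteq> U" by blast
    then have bE: "b \<in> edges G" by (simp add: fractional_def)
    let ?v = "Poly_Mapping.single a 1 - Poly_Mapping.single b (1::real)"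
    have sums: "sum (Poly_Mapping.lookup ?v) (edges_in G W)
        = (if a \<subseteq> W then 1 else 0) - (if b \<subseteq> W then 1 else 0)" for W
      using aE bE sum_lookup_single[OF fin]
      by (simp add: lookup_minus sum_subtractf edges_in_def del: lookup_single)
    have keys: "Poly_Mapping.keys ?v \<subseteq> edges G"
      using aE bE by (auto simp: in_keys_iff lookup_minus lookup_single when_def split: if_splits)
    show ?thesis
    proof (intro exI[of _ ?v] conjI keys)
      show "\<forall>e\<in>edges G. x e = 0 \<longrightarrow> Poly_Mapping.lookup ?v e = 0"
        using bounds[OF a(1)] bounds[OF b(1)] by (auto simp: lookup_minus lookup_single when_def)
      show "\<exists>W. W \<subseteq> verts G \<and> W \<noteq> {} \<and> 0 < sum (Poly_Mapping.lookup ?v) (edges_in G W)"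
      proof (intro exI[of _ a] conjI single(2,3)[OF aE])
        \<comment> \<open>The vertex set \<open>a\<close> spans no edge other than \<open>a\<close>,
          so its constraint has rate 1.\<close>
        have "\<not> b \<subseteq> a" using single(1)[OF aE] bE b(2) by (auto simp: edges_in_def)
        then show "0 < sum (Poly_Mapping.lookup ?v) (edges_in G a)" by (simp add: sums)
      qed
      show "\<forall>W. W \<subseteq> verts G \<and> W \<noteq> {} \<and> sum x (edges_in G W) = real (card W) - 1
        \<longrightarrow> sum (Poly_Mapping.lookup ?v) (edges_in G W) = 0"
      proof (intro allI impI)
        fix W assume "W \<subseteq> verts G \<and> W \<noteq> {} \<and> sum x (edges_in G W) = real (card W) - 1"
        then have "tight W" by (simp add: tight_def)
        then have "a \<subseteq> W \<longleftrightarrow> b \<subseteq> W"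
          using same[of W a] same[of W b] a b by blast
        then show "sum (Poly_Mapping.lookup ?v) (edges_in G W) = 0" by (simp add: sums)
      qed
      show "\<exists>e\<in>edges G. 0 < Poly_Mapping.lookup ?v e"
        using aE b by (intro bexI[of _ a]) (auto simp: lookup_minus lookup_single when_def)
    qed
  qed
qed

text \<open>Points of the hull satisfy the constraint of \<open>U\<close> because they are
  orientable from a root chosen in \<open>U\<close>. Conversely, a point of the polyhedron outside
  the hull has a fractional coordinate by \<open>forest_ineqs_integral\<close>, and
  \<open>forest_ineqs_direction\<close> then supplies the direction required by
  \<open>polyhedron_in_convex\<close>.\<close>

lemma forest_polytope_eq:
  assumes G: "simple_graph G"
  shows "forest_polytope G = {x. Poly_Mapping.keys x \<subseteq> edges G \<and> Poly_Mapping.lookup x \<in> forest_ineqs G}"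
proof (rule equalityI; rule subsetI)
  fix x assume x: "x \<in> forest_polytope G"
  note orientable = forest_polytope_orientable[OF G x]
  have "Poly_Mapping.lookup x \<in> forest_ineqs G"
    unfolding forest_ineqs_def
  proof (intro CollectI conjI ballI allI impI)
    show "0 \<le> Poly_Mapping.lookup x e" if "e \<in> edges G" for e
      using orientable that by (rule orientable_nonneg)
    fix U assume U: "U \<subseteq> verts G \<and> U \<noteq> {}"
    then obtain r where "r \<in> U" by blast
    then show "sum (Poly_Mapping.lookup x) (edges_in G U) \<le> real (card U) - 1"
      using orientable_sum_le[OF G orientable] U by blast
  qed
  then show "x \<in> {x. Poly_Mapping.keys x \<subseteq> edges G \<and> Poly_Mapping.lookup x \<in> forest_ineqs G}"
    using forest_polytope_keys[OF x] by simp
next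
  fix x assume x: "x \<in> {x. Poly_Mapping.keys x \<subseteq> edges G \<and> Poly_Mapping.lookup x \<in> forest_ineqs G}"
  define K where "K = edges G <+> {U. U \<subseteq> verts G \<and> U \<noteq> {}}"
  define slack :: "('a set \<Rightarrow>\<^sub>0 real) \<Rightarrow> 'a set + 'a set \<Rightarrow> real" where
    "slack z k = (case k of Inl e \<Rightarrow> Poly_Mapping.lookup z e
                  | Inr U \<Rightarrow> real (card U) - 1 - sum (Poly_Mapping.lookup z) (edges_in G U))" for z k
  \<comment> \<open>The rate is the speed at which a slack decreases along \<open>v\<close>, hence
    the minus sign for the nonnegativity constraints.\<close>
  define rate :: "('a set \<Rightarrow>\<^sub>0 real) \<Rightarrow> 'a set + 'a set \<Rightarrow> real" where
    "rate v k = (case k of Inl e \<Rightarrow> - Poly_Mapping.lookup v e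
                 | Inr U \<Rightarrow> sum (Poly_Mapping.lookup v) (edges_in G U))" for v k
  have slack: "(\<forall>k\<in>K. 0 \<le> slack z k) \<longleftrightarrow> Poly_Mapping.lookup z \<in> forest_ineqs G" for z
  proof -
    have "(\<forall>k\<in>K. 0 \<le> slack z k) \<longleftrightarrow> (\<forall>e\<in>edges G. 0 \<le> slack z (Inl e))
        \<and> (\<forall>U\<in>{U. U \<subseteq> verts G \<and> U \<noteq> {}}. 0 \<le> slack z (Inr U))"
      unfolding K_def by blast
    then show ?thesis by (simp add: slack_def forest_ineqs_def)
  qed
  show "x \<in> forest_polytope G"
  proof (rule polyhedron_in_convex[where K = K and slack = slack and rate = rate])
    show "finite K" using G simple_graph_finite_edges[OF G] by (auto simp: K_def simple_graph_def)
    show "subspace {x :: 'a set \<Rightarrow>\<^sub>0 real. Poly_Mapping.keys x \<subseteq> edges G}" by (rule subspace_keys)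
    show "convex (forest_polytope G)" by (simp add: forest_polytope_def)
    show "slack (z + t *\<^sub>R v) k = slack z k - t * rate v k" for z t v k
      by (cases k) (simp_all add: slack_def rate_def lookup_add lookup_scaleR sum.distrib sum_distrib_left)
    show "x \<in> {x. Poly_Mapping.keys x \<subseteq> edges G}" "\<forall>k\<in>K. 0 \<le> slack x k"
      using x slack by auto
  next
    fix z assume z: "z \<in> {x. Poly_Mapping.keys x \<subseteq> edges G}" "\<forall>k\<in>K. 0 \<le> slack z k" "z \<notin> forest_polytope G"
    have ineqs: "Poly_Mapping.lookup z \<in> forest_ineqs G" using z slack by blast
    have "\<exists>e\<in>edges G. Poly_Mapping.lookup z e \<notin> {0, 1}"
      using forest_ineqs_integral[OF G _ ineqs] z by blast
    from forest_ineqs_direction[OF G ineqs this] obtain v :: "'a set \<Rightarrow>\<^sub>0 real" where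
      v: "Poly_Mapping.keys v \<subseteq> edges G"
        "\<forall>e\<in>edges G. Poly_Mapping.lookup z e = 0 \<longrightarrow> Poly_Mapping.lookup v e = 0"
        "\<forall>U. U \<subseteq> verts G \<and> U \<noteq> {} \<and> sum (Poly_Mapping.lookup z) (edges_in G U) = real (card U) - 1
          \<longrightarrow> sum (Poly_Mapping.lookup v) (edges_in G U) = 0"
        "\<exists>U. U \<subseteq> verts G \<and> U \<noteq> {} \<and> 0 < sum (Poly_Mapping.lookup v) (edges_in G U)"
        "\<exists>e\<in>edges G. 0 < Poly_Mapping.lookup v e"
      by - (erule exE, elim conjE, rule that)
    show "\<exists>v\<in>{x. Poly_Mapping.keys x \<subseteq> edges G}. (\<forall>k\<in>K. slack z k = 0 \<longrightarrow> rate v k = 0)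
        \<and> (\<exists>k\<in>K. 0 < rate v k) \<and> (\<exists>k\<in>K. rate v k < 0)"
    proof (intro bexI[of _ v] conjI)
      show "\<forall>k\<in>K. slack z k = 0 \<longrightarrow> rate v k = 0"
      proof (intro ballI impI)
        fix k assume k: "k \<in> K" "slack z k = 0"
        show "rate v k = 0"
        proof (cases k)
          case (Inl e)
          then show ?thesis using k v(2) by (simp add: K_def slack_def rate_def Plus_def image_iff)
        next
          case (Inr U)
          then have "U \<subseteq> verts G \<and> U \<noteq> {} \<and> sum (Poly_Mapping.lookup z) (edges_in G U) = real (card U) - 1"
            using k by (simp add: K_def slack_def Plus_def image_iff)
          then show ?thesis using v(3) Inr by (simp add: rate_def)
        qed
      qed
      obtain U where "U \<subseteq> verts G" "U \<noteq> {}" "0 < sum (Poly_Mapping.lookup v) (edges_in G U)"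
        using v(4) by blast
      then show "\<exists>k\<in>K. 0 < rate v k" by (intro bexI[of _ "Inr U"]) (simp_all add: K_def rate_def InrI)
      obtain e where "e \<in> edges G" "0 < Poly_Mapping.lookup v e" using v(5) by blast
      then show "\<exists>k\<in>K. rate v k < 0" by (intro bexI[of _ "Inl e"]) (simp_all add: K_def rate_def InlI)
    qed (use v(1) in simp)
  qed
qed

section \<open>Size of the orientation system\<close>

lemma card_incidences:
  assumes "simple_graph G"
  shows "finite (Sigma (edges G) (\<lambda>e. e))" "card (Sigma (edges G) (\<lambda>e. e)) = 2 * card (edges G)"
proof -
  have fin: "finite (edges G)" using assms by (rule simple_graph_finite_edges)
  have e: "finite e" "card e = 2" if "e \<in> edges G" for e
    using assms that by (auto simp: simple_graph_def intro: card_ge_0_finite)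
  show "finite (Sigma (edges G) (\<lambda>e. e))" using fin e by simp
  show "card (Sigma (edges G) (\<lambda>e. e)) = 2 * card (edges G)"
    using fin e by (simp add: card_SigmaI)
qed

text \<open>The inequalities are one sign condition per incidence and one capacity per vertex. The
  point \<open>x\<close> enters only the equalities that tie it to \<open>y\<close>, and these do
  not count.\<close>

lemma formulation_orientable:
  assumes G: "simple_graph G"
  shows "formulation (edges G) (orientable G r) (2 * card (edges G) + card (verts G))"
proof -
  define J where "J = Sigma (edges G) (\<lambda>e. e)"
  have J: "finite J" "card J = 2 * card (edges G)" using card_incidences[OF G] by (simp_all add: J_def)
  have finV: "finite (verts G)" using G by (simp add: simple_graph_def)
  have finE: "finite (edges G)" using G by (rule simple_graph_finite_edges)
  define B :: "('a set \<times> 'a) + 'a \<Rightarrow> 'a set \<times> 'a \<Rightarrow> real" where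
    "B i j = (case i of Inl j' \<Rightarrow> if j = j' then - 1 else 0 | Inr v \<Rightarrow> if snd j = v then 1 else 0)" for i j
  define b :: "('a set \<times> 'a) + 'a \<Rightarrow> real" where
    "b i = (case i of Inl j' \<Rightarrow> 0 | Inr v \<Rightarrow> if v = r then 0 else 1)" for i
  define C :: "'a set \<Rightarrow> 'a set \<Rightarrow> real" where "C e e' = (if e' = e then - 1 else 0)" for e e'
  define D :: "'a set \<Rightarrow> 'a set \<times> 'a \<Rightarrow> real" where "D e j = (if fst j = e then 1 else 0)" for e j
  have Inl: "(\<Sum>j\<in>J. B (Inl j') j * y j) = - y j'" if "j' \<in> J" for j' y
  proof -
    have "(\<Sum>j\<in>J. B (Inl j') j * y j) = (\<Sum>j\<in>J. if j = j' then - y j else 0)"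
      by (rule sum.cong) (auto simp: B_def)
    then show ?thesis using J that by simp
  qed
  have Inr: "(\<Sum>j\<in>J. B (Inr v) j * y j) = (\<Sum>e | e \<in> edges G \<and> v \<in> e. y (e, v))" for v y
  proof -
    have "(\<Sum>j\<in>J. B (Inr v) j * y j) = (\<Sum>j\<in>(\<lambda>e. (e, v)) ` {e. e \<in> edges G \<and> v \<in> e}. y j)"
      using J(1) by (intro sum.mono_neutral_cong_right) (auto simp: B_def J_def)
    then show ?thesis by (simp add: sum.reindex inj_on_def)
  qed
  have D: "(\<Sum>j\<in>J. D e j * y j) = (\<Sum>v\<in>e. y (e, v))" if "e \<in> edges G" for e y
  proof -
    have "(\<Sum>j\<in>J. D e j * y j) = (\<Sum>j\<in>Pair e ` e. y j)"
      using J(1) that by (intro sum.mono_neutral_cong_right) (auto simp: D_def J_def)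
    then show ?thesis by (simp add: sum.reindex inj_on_def)
  qed
  have C: "(\<Sum>e'\<in>edges G. C e e' * x e') = - x e" if "e \<in> edges G" for e x
  proof -
    have "(\<Sum>e'\<in>edges G. C e e' * x e') = (\<Sum>e'\<in>edges G. if e' = e then - x e' else 0)"
      by (rule sum.cong) (auto simp: C_def)
    then show ?thesis using finE that by simp
  qed
  have iff: "(\<forall>i\<in>J <+> verts G. (\<Sum>e\<in>edges G. 0 * x e) + (\<Sum>j\<in>J. B i j * y j) \<le> b i) \<and>
        (\<forall>e\<in>edges G. (\<Sum>e'\<in>edges G. C e e' * x e') + (\<Sum>j\<in>J. D e j * y j) = 0)
      \<longleftrightarrow> (\<forall>e\<in>edges G. \<forall>v\<in>e. 0 \<le> y (e, v)) \<and>
        (\<forall>v\<in>verts G. (\<Sum>e | e \<in> edges G \<and> v \<in> e. y (e, v)) \<le> (if v = r then 0 else 1)) \<and>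
        (\<forall>e\<in>edges G. (\<Sum>v\<in>e. y (e, v)) = x e)" for x y
  proof -
    have "(\<forall>i\<in>J <+> verts G. (\<Sum>j\<in>J. B i j * y j) \<le> b i)
        \<longleftrightarrow> (\<forall>j\<in>J. (\<Sum>j'\<in>J. B (Inl j) j' * y j') \<le> 0)
          \<and> (\<forall>v\<in>verts G. (\<Sum>j\<in>J. B (Inr v) j * y j) \<le> (if v = r then 0 else 1))"
      unfolding Plus_def ball_Un ball_simps b_def by simp
    also have "\<dots> \<longleftrightarrow> (\<forall>j\<in>J. 0 \<le> y j)
          \<and> (\<forall>v\<in>verts G. (\<Sum>e | e \<in> edges G \<and> v \<in> e. y (e, v)) \<le> (if v = r then 0 else 1))"
      unfolding Inr by (simp add: Inl)
    also have "(\<forall>j\<in>J. 0 \<le> y j) \<longleftrightarrow> (\<forall>e\<in>edges G. \<forall>v\<in>e. 0 \<le> y (e, v))"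
      by (auto simp: J_def)
    finally show ?thesis by (simp add: C D)
  qed
  have "formulation (edges G)
      {x. \<exists>y. (\<forall>i\<in>J <+> verts G. (\<Sum>e\<in>edges G. 0 * x e) + (\<Sum>j\<in>J. B i j * y j) \<le> b i) \<and>
              (\<forall>e\<in>edges G. (\<Sum>e'\<in>edges G. C e e' * x e') + (\<Sum>j\<in>J. D e j * y j) = 0)}
      (card (J <+> verts G))"
    using J finV finE by (intro formulation_indexed) auto
  then have "formulation (edges G) (orientable G r) (card (J <+> verts G))"
    by (simp only: iff orientable_def)
  then show ?thesis using J finV by (simp add: card_Plus)
qed

section \<open>Separators\<close>

lemma induced_eq_graph_unionD:
  assumes "induced G W = graph_union (induced G V\<^sub>1) (induced G V\<^sub>2)"
  shows "V\<^sub>1 \<union> V\<^sub>2 = W"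
    and "{e\<in>edges G. e \<subseteq> W} = {e\<in>edges G. e \<subseteq> V\<^sub>1} \<union> {e\<in>edges G. e \<subseteq> V\<^sub>2}"
  using arg_cong[OF assms, of verts] arg_cong[OF assms, of edges]
  by (simp_all add: induced_def graph_union_def)

text \<open>This is where Edmonds' theorem is used for the recursion: a point satisfying all
  inequalities is a convex combination of forests on the edges of \<open>G\<close>, hence orientable
  from every root.\<close>

lemma forest_ineqs_orientable:
  assumes G: "simple_graph G" and x: "x \<in> forest_ineqs G"
  shows "x \<in> orientable G r"
proof -
  have fin: "finite (edges G)" using G by (rule simple_graph_finite_edges)
  \<comment> \<open>Truncating \<open>x\<close> to the edges makes it finitely supported; both
    properties ignore the values elsewhere.\<close>
  define z where "z = (\<Sum>e\<in>edges G. Poly_Mapping.single e (x e))"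
  have z: "Poly_Mapping.lookup z e = (if e \<in> edges G then x e else 0)" for e
    using fin by (simp add: z_def lookup_sum lookup_single when_def)
  have "sum (Poly_Mapping.lookup z) (edges_in G U) = sum x (edges_in G U)" for U
    by (rule sum.cong) (auto simp: z edges_in_def)
  then have "Poly_Mapping.lookup z \<in> forest_ineqs G"
    using x by (simp add: forest_ineqs_def z)
  moreover have "Poly_Mapping.keys z \<subseteq> edges G" by (auto simp: in_keys_iff z split: if_splits)
  ultimately have "Poly_Mapping.lookup z \<in> orientable G r"
    by (intro forest_polytope_orientable[OF G]) (simp add: forest_polytope_eq[OF G])
  then show ?thesis by (simp add: orientable_def z)
qed

lemma edges_in_induced: "edges_in (induced G W) U = edges_in G (U \<inter> W)"
  by (auto simp: edges_in_def induced_def)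

text \<open>
  The constraint of a vertex set \<open>U\<close> that meets \<open>X\<close> in \<open>r\<close> follows from orientability with root
  \<open>r\<close>; otherwise \<open>U\<close> splits into its parts in \<open>V\<^sub>1\<close> and \<open>V\<^sub>2\<close>.
\<close>

lemma forest_ineqs_separator:
  assumes G: "simple_graph G" and X: "X \<subseteq> verts G" and disj: "V\<^sub>1 \<inter> V\<^sub>2 = {}"
    and sep: "induced G (verts G - X) = graph_union (induced G V\<^sub>1) (induced G V\<^sub>2)"
  shows "forest_ineqs G = forest_ineqs (induced G V\<^sub>1) \<inter> forest_ineqs (induced G V\<^sub>2) \<inter> (\<Inter>r\<in>X. orientable G r)"
proof (rule equalityI; rule subsetI)
  have V: "V\<^sub>1 \<union> V\<^sub>2 = verts G - X" by (rule induced_eq_graph_unionD(1)[OF sep])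
  fix x assume x: "x \<in> forest_ineqs G"
  have "x \<in> forest_ineqs (induced G W)" if "W \<subseteq> verts G" for W
    unfolding forest_ineqs_def
  proof (intro CollectI conjI ballI allI impI)
    show "0 \<le> x e" if "e \<in> edges (induced G W)" for e
      using that by (intro forest_ineqsD(1)[OF x]) (simp add: induced_def)
    fix U assume "U \<subseteq> verts (induced G W) \<and> U \<noteq> {}"
    then have U: "U \<subseteq> W" "U \<noteq> {}" by (simp_all add: induced_def)
    then have "U \<inter> W = U" by blast
    then show "sum x (edges_in (induced G W) U) \<le> real (card U) - 1"
      using U that forest_ineqsD(2)[OF x, of U] by (simp add: edges_in_induced)
  qed
  moreover have "V\<^sub>1 \<subseteq> verts G" "V\<^sub>2 \<subseteq> verts G" using V by auto
  ultimately show "x \<in> forest_ineqs (induced G V\<^sub>1) \<inter> forest_ineqs (induced G V\<^sub>2) \<inter> (\<Inter>r\<in>X. orientable G r)"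
    using forest_ineqs_orientable[OF G x] by blast
next
  have V: "V\<^sub>1 \<union> V\<^sub>2 = verts G - X" by (rule induced_eq_graph_unionD(1)[OF sep])
  have E: "{e\<in>edges G. e \<subseteq> verts G - X} = {e\<in>edges G. e \<subseteq> V\<^sub>1} \<union> {e\<in>edges G. e \<subseteq> V\<^sub>2}"
    by (rule induced_eq_graph_unionD(2)[OF sep])
  have fin: "finite (edges_in G T)" for T
    using simple_graph_finite_edges[OF G] by (simp add: edges_in_def)
  fix x assume "x \<in> forest_ineqs (induced G V\<^sub>1) \<inter> forest_ineqs (induced G V\<^sub>2) \<inter> (\<Inter>r\<in>X. orientable G r)"
  then have x\<^sub>1: "x \<in> forest_ineqs (induced G V\<^sub>1)" and x\<^sub>2: "x \<in> forest_ineqs (induced G V\<^sub>2)"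
    and r: "\<And>r. r \<in> X \<Longrightarrow> x \<in> orientable G r"
    by blast+
  \<comment> \<open>An empty part contributes 0 instead of -1. Since at least one part of
    \<open>U\<close> is nonempty, the two bounds still add up to at most
    \<open>card U - 1\<close>.\<close>
  have part: "sum x (edges_in G (U \<inter> W)) \<le> real (card (U \<inter> W)) - (if U \<inter> W = {} then 0 else 1)"
    if "x \<in> forest_ineqs (induced G W)" for U W
  proof (cases "U \<inter> W = {}")
    case True
    have "edges_in G {} = {}" using G by (auto simp: edges_in_def simple_graph_def)
    then show ?thesis using True by simp
  next
    case False
    have "sum x (edges_in (induced G W) (U \<inter> W)) \<le> real (card (U \<inter> W)) - 1"
      using False by (intro forest_ineqsD(2)[OF that]) (auto simp: induced_def)
    then show ?thesis using False by (simp add: edges_in_induced)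
  qed
  show "x \<in> forest_ineqs G"
    unfolding forest_ineqs_def
  proof (intro CollectI conjI ballI allI impI)
    fix e assume e: "e \<in> edges G"
    show "0 \<le> x e"
    proof (cases "e \<inter> X = {}")
      case True
      then have "e \<in> {e\<in>edges G. e \<subseteq> verts G - X}" using e G by (auto simp: simple_graph_def)
      then have "e \<in> edges (induced G V\<^sub>1) \<or> e \<in> edges (induced G V\<^sub>2)"
        unfolding E by (auto simp: induced_def)
      then show ?thesis using forest_ineqsD(1)[OF x\<^sub>1] forest_ineqsD(1)[OF x\<^sub>2] by blast
    next
      case False
      \<comment> \<open>Edges meeting \<open>X\<close> belong to neither side; their nonnegativity
        comes from the orientation system of a root in \<open>X\<close>.\<close>
      then obtain v where "v \<in> X" by blast
      then show ?thesis using r e by (intro orientable_nonneg)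
    qed
  next
    fix U assume U: "U \<subseteq> verts G \<and> U \<noteq> {}"
    show "sum x (edges_in G U) \<le> real (card U) - 1"
    proof (cases "U \<inter> X = {}")
      case True
      then have U12: "U = (U \<inter> V\<^sub>1) \<union> (U \<inter> V\<^sub>2)" using U V by blast
      have "edges_in G U = edges_in G (U \<inter> V\<^sub>1) \<union> edges_in G (U \<inter> V\<^sub>2)"
      proof -
        have "edges_in G U \<subseteq> {e\<in>edges G. e \<subseteq> verts G - X}" using True U by (auto simp: edges_in_def)
        then show ?thesis unfolding E by (auto simp: edges_in_def)
      qed
      moreover have "edges_in G (U \<inter> V\<^sub>1) \<inter> edges_in G (U \<inter> V\<^sub>2) = {}"
      proof -
        have "e = {}" if "e \<subseteq> V\<^sub>1" "e \<subseteq> V\<^sub>2" for e using that disj by blast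
        moreover have "{} \<notin> edges G" using G by (auto simp: simple_graph_def)
        ultimately show ?thesis unfolding edges_in_def by blast
      qed
      ultimately have "sum x (edges_in G U) = sum x (edges_in G (U \<inter> V\<^sub>1)) + sum x (edges_in G (U \<inter> V\<^sub>2))"
        using fin by (simp add: sum.union_disjoint)
      moreover have "card U = card (U \<inter> V\<^sub>1) + card (U \<inter> V\<^sub>2)"
      proof -
        have "finite U" using U G by (meson finite_subset simple_graph_def)
        then have "card ((U \<inter> V\<^sub>1) \<union> (U \<inter> V\<^sub>2)) = card (U \<inter> V\<^sub>1) + card (U \<inter> V\<^sub>2)"
          using disj by (intro card_Un_disjoint) auto
        then show ?thesis using U12 by simp
      qed
      moreover have "U \<inter> V\<^sub>1 \<noteq> {} \<or> U \<inter> V\<^sub>2 \<noteq> {}" using U U12 by blast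
      ultimately show ?thesis using part[OF x\<^sub>1, of U] part[OF x\<^sub>2, of U] by (auto split: if_splits)
    next
      case False
      then obtain v where "v \<in> U" "v \<in> X" by blast
      then show ?thesis using orientable_sum_le[OF G r, of v U] U by blast
    qed
  qed
qed

section \<open>Linear edge bound from sublinear separators\<close>

text \<open>As \<open>\<gamma> - 1 < 0\<close>, each positive \<open>t \<le> q * n\<close> has
  \<open>t powr (\<gamma> - 1) \<ge> (q * n) powr (\<gamma> - 1)\<close>. For \<open>q < 1\<close>
  the factor \<open>q powr (\<gamma> - 1)\<close> exceeds 1: this is the growth of the correction
  term under splitting.\<close>

lemma powr_sum_ge:
  fixes a b n q \<gamma> :: real
  assumes "\<gamma> < 1" "0 < n" "0 < q" "0 \<le> a" "0 \<le> b" "a \<le> q * n" "b \<le> q * n" "n \<le> a + b"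
  shows "q powr (\<gamma> - 1) * n powr \<gamma> \<le> a powr \<gamma> + b powr \<gamma>"
proof -
  have le: "t * (q * n) powr (\<gamma> - 1) \<le> t powr \<gamma>" if "0 \<le> t" "t \<le> q * n" for t
  proof (cases "t = 0")
    case False
    then have "(q * n) powr (\<gamma> - 1) \<le> t powr (\<gamma> - 1)"
      using that assms by (intro powr_mono2') auto
    then have "t * (q * n) powr (\<gamma> - 1) \<le> t * t powr (\<gamma> - 1)" using that by (intro mult_left_mono)
    also have "\<dots> = t powr \<gamma>" using that False by (simp add: powr_mult_base)
    finally show ?thesis .
  qed simp
  have "q powr (\<gamma> - 1) * n powr \<gamma> = n * (q * n) powr (\<gamma> - 1)"
    using assms by (simp add: powr_mult powr_mult_base mult.left_commute)
  also have "\<dots> \<le> (a + b) * (q * n) powr (\<gamma> - 1)"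
    using assms by (intro mult_right_mono) auto
  also have "\<dots> \<le> a powr \<gamma> + b powr \<gamma>"
    using le[of a] le[of b] assms by (simp add: distrib_right)
  finally show ?thesis .
qed

text \<open>The opposite effect for exponents above 1: one factor \<open>t powr \<beta>\<close> is
  bounded by \<open>(q * n) powr \<beta>\<close>. For \<open>q < 1\<close> the factor
  \<open>q powr \<beta>\<close> makes the costs of the recursion shrink.\<close>

lemma powr_sum_le:
  fixes a b n q \<beta> :: real
  assumes "0 < \<beta>" "0 \<le> n" "0 < q" "0 \<le> a" "0 \<le> b" "a \<le> q * n" "b \<le> q * n" "a + b \<le> n"
  shows "a powr (1 + \<beta>) + b powr (1 + \<beta>) \<le> q powr \<beta> * n powr (1 + \<beta>)"
proof -
  have le: "t powr (1 + \<beta>) \<le> t * (q * n) powr \<beta>" if "0 \<le> t" "t \<le> q * n" for t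
  proof -
    have "t powr (1 + \<beta>) = t * t powr \<beta>" using that by (simp add: powr_mult_base)
    also have "\<dots> \<le> t * (q * n) powr \<beta>"
      using that assms by (intro mult_left_mono powr_mono2) auto
    finally show ?thesis .
  qed
  have "a powr (1 + \<beta>) + b powr (1 + \<beta>) \<le> (a + b) * (q * n) powr \<beta>"
    using le[of a] le[of b] assms by (simp add: distrib_right)
  also have "\<dots> \<le> n * (q * n) powr \<beta>" using assms by (intro mult_right_mono) auto
  also have "\<dots> = q powr \<beta> * n powr (1 + \<beta>)"
    using assms by (simp add: powr_mult powr_mult_base[symmetric] mult.left_commute)
  finally show ?thesis .
qed

lemma card_edges_le_square:
  assumes "simple_graph G"
  shows "card (edges G) \<le> card (verts G) ^ 2"
proof -
  have fin: "finite (verts G)" using assms by (simp add: simple_graph_def)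
  have "edges G \<subseteq> (\<lambda>(a, b). {a, b}) ` (verts G \<times> verts G)"
  proof
    fix e assume e: "e \<in> edges G"
    then have "card e = 2" "e \<subseteq> verts G" using assms by (auto simp: simple_graph_def)
    then obtain a b where "e = {a, b}" by (auto simp: card_2_iff)
    then show "e \<in> (\<lambda>(a, b). {a, b}) ` (verts G \<times> verts G)" using \<open>e \<subseteq> verts G\<close> by force
  qed
  then have "card (edges G) \<le> card (verts G \<times> verts G)" using fin by (intro surj_card_le) auto
  then show ?thesis by (simp add: card_cartesian_product power2_eq_square)
qed

text \<open>
  The potential \<open>a * n - a / 2 * n powr \<gamma>\<close> with \<open>\<beta> < \<gamma> < 1\<close>: since \<open>n powr \<gamma>\<close> grows by a
  constant factor when \<open>G\<close> is replaced by its two parts, each together with \<open>X\<close>, the second term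
  pays for counting \<open>X\<close> twice.
\<close>

lemma linearly_many_edges:
  fixes \<G> :: "'a ugraph set" and \<beta> c :: real
  assumes simple: "\<And>G. G \<in> \<G> \<Longrightarrow> simple_graph G"
    and closed: "closed_under_induced_subgraphs \<G>"
    and "\<beta> < 1"
    and sep: "\<And>G. G \<in> \<G> \<Longrightarrow> 0 < card (verts G) \<Longrightarrow>
      \<exists>X. balanced_separator (1/2) G X \<and> real (card X) \<le> c * real (card (verts G)) powr \<beta>"
  shows "\<exists>a\<ge>0. \<forall>G\<in>\<G>. real (card (edges G)) \<le> a * real (card (verts G))"
proof -
  define \<gamma> where "\<gamma> = (1 + \<beta>) / 2"
  \<comment> \<open>\<open>1 + \<delta>\<close> is the growth factor of \<open>powr_sum_ge\<close>
    for \<open>q = 2/3\<close>.\<close>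
  define \<delta> where "\<delta> = (2/3) powr (\<gamma> - 1) - (1::real)"
  have \<gamma>: "\<gamma> < 1" "\<beta> < \<gamma>" using \<open>\<beta> < 1\<close> by (auto simp: \<gamma>_def)
  have \<delta>: "0 < \<delta>" using \<gamma> by (auto simp: \<delta>_def powr_def intro!: mult_neg_neg)
  \<comment> \<open>The first bound leaves each side together with \<open>X\<close> at most
    \<open>n / 2 + n / 6 = 2/3 * n\<close> vertices. The second makes the cost of counting
    \<open>X\<close> twice at most \<open>a * \<delta> / 2 * n powr \<gamma>\<close>, exactly the
    gain in the second term of the potential.\<close>
  have "eventually (\<lambda>n. c * real n powr \<beta> \<le> real n / 6 \<and> c * real n powr \<beta> \<le> \<delta> / 2 * real n powr \<gamma>) sequentially"
  proof (intro eventually_conj)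
    show "eventually (\<lambda>n. c * real n powr \<beta> \<le> real n / 6) sequentially"
      using \<open>\<beta> < 1\<close> by real_asymp
    show "eventually (\<lambda>n. c * real n powr \<beta> \<le> \<delta> / 2 * real n powr \<gamma>) sequentially"
      using \<gamma> \<delta> by real_asymp
  qed
  then obtain n\<^sub>0 where n\<^sub>0: "\<And>n. n \<ge> n\<^sub>0 \<Longrightarrow> c * real n powr \<beta> \<le> real n / 6"
      "\<And>n. n \<ge> n\<^sub>0 \<Longrightarrow> c * real n powr \<beta> \<le> \<delta> / 2 * real n powr \<gamma>"
    unfolding eventually_sequentially by blast
  \<comment> \<open>For \<open>n < n\<^sub>0\<close> there are at most
    \<open>n * n \<le> a / 2 * n\<close> edges, and this is below the potential because
    \<open>n powr \<gamma> \<le> n\<close>.\<close>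
  define a where "a = 2 * real n\<^sub>0"
  have "0 \<le> a" by (simp add: a_def)
  have bound: "real (card (edges G)) \<le> a * real (card (verts G)) - a / 2 * real (card (verts G)) powr \<gamma>"
    if "G \<in> \<G>" for G
    using that
  proof (induction "card (verts G)" arbitrary: G rule: less_induct)
    case less
    define n where "n = card (verts G)"
    have G: "simple_graph G" using less.prems by (rule simple)
    have finV: "finite (verts G)" using G by (simp add: simple_graph_def)
    show ?case
    proof (cases "n = 0 \<or> n < n\<^sub>0")
      case True
      have "real n powr \<gamma> \<le> real n"
      proof (cases "n = 0")
        case False
        then have "real n powr \<gamma> \<le> real n powr 1" using \<gamma> by (intro powr_mono) auto
        then show ?thesis by simp
      qed simp
      then have "a / 2 * real n powr \<gamma> \<le> a / 2 * real n" using \<open>0 \<le> a\<close> by (intro mult_left_mono) auto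
      moreover have "real (card (edges G)) \<le> a / 2 * real n"
      proof -
        have "card (edges G) \<le> n * n"
          using card_edges_le_square[OF G] by (simp add: n_def power2_eq_square)
        also have "\<dots> \<le> n\<^sub>0 * n" using True by (intro mult_right_mono) auto
        finally have "real (card (edges G)) \<le> real (n\<^sub>0 * n)" by (simp only: of_nat_le_iff)
        then show ?thesis by (simp add: a_def)
      qed
      ultimately show ?thesis by (simp add: n_def)
    next
      case False
      then have n: "0 < n" "n\<^sub>0 \<le> n" by auto
      obtain X where "balanced_separator (1/2) G X" and cX: "real (card X) \<le> c * real n powr \<beta>"
        using sep[OF less.prems] n by (auto simp: n_def)
      then obtain V\<^sub>1 V\<^sub>2 where X: "X \<subseteq> verts G" and disj: "V\<^sub>1 \<inter> V\<^sub>2 = {}"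
        and VE: "induced G (verts G - X) = graph_union (induced G V\<^sub>1) (induced G V\<^sub>2)"
        and half: "real (card V\<^sub>1) \<le> real n / 2" "real (card V\<^sub>2) \<le> real n / 2"
        by (auto simp: balanced_separator_def n_def)
      have V: "V\<^sub>1 \<union> V\<^sub>2 = verts G - X" by (rule induced_eq_graph_unionD(1)[OF VE])
      have E: "{e\<in>edges G. e \<subseteq> verts G - X} = {e\<in>edges G. e \<subseteq> V\<^sub>1} \<union> {e\<in>edges G. e \<subseteq> V\<^sub>2}"
        by (rule induced_eq_graph_unionD(2)[OF VE])
      have V12: "V\<^sub>1 \<subseteq> verts G" "V\<^sub>2 \<subseteq> verts G" using V by auto
      have fin: "finite V\<^sub>1" "finite V\<^sub>2" "finite X"
        using V12 X finV by (simp_all add: finite_subset)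
      define N where "N W = card (W \<union> X)" for W
      have N: "N V\<^sub>1 = card V\<^sub>1 + card X" "N V\<^sub>2 = card V\<^sub>2 + card X"
        unfolding N_def using fin V by (auto intro!: card_Un_disjoint)
      have total: "card V\<^sub>1 + card V\<^sub>2 + card X = n"
      proof -
        have "n = card ((V\<^sub>1 \<union> V\<^sub>2) \<union> X)" using V X by (simp add: n_def Un_absorb2)
        also have "\<dots> = card (V\<^sub>1 \<union> V\<^sub>2) + card X"
        proof (rule card_Un_disjoint)
          show "finite (V\<^sub>1 \<union> V\<^sub>2)" using fin by simp
          show "(V\<^sub>1 \<union> V\<^sub>2) \<inter> X = {}" using V by blast
        qed (rule fin)
        also have "card (V\<^sub>1 \<union> V\<^sub>2) = card V\<^sub>1 + card V\<^sub>2" using fin disj by (intro card_Un_disjoint) auto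
        finally show ?thesis by simp
      qed
      have N_le: "real (N V\<^sub>1) \<le> 2/3 * real n" "real (N V\<^sub>2) \<le> 2/3 * real n"
        using N half cX n\<^sub>0(1)[OF n(2)] by simp_all
      have IH: "real (card (edges (induced G (W \<union> X)))) \<le> a * real (N W) - a / 2 * real (N W) powr \<gamma>"
        if "W \<subseteq> verts G" "real (N W) \<le> 2/3 * real n" for W
      proof -
        have "induced G (W \<union> X) \<in> \<G>"
          using closed less.prems X that by (simp add: closed_under_induced_subgraphs_def)
        moreover have "card (verts (induced G (W \<union> X))) = N W" by (simp add: induced_def N_def)
        moreover have "N W < n" using that n by linarith
        ultimately show ?thesis using less.hyps[of "induced G (W \<union> X)"] by (simp add: n_def)
      qed
      \<comment> \<open>An edge meeting \<open>X\<close> has its other end in \<open>X\<close> or in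
        one side, so one of the two overlapping graphs contains it; this is why \<open>X\<close> is
        kept in both.\<close>
      have "edges G \<subseteq> edges (induced G (V\<^sub>1 \<union> X)) \<union> edges (induced G (V\<^sub>2 \<union> X))"
      proof
        fix e assume e: "e \<in> edges G"
        then have eV: "e \<subseteq> verts G" using G by (simp add: simple_graph_def)
        show "e \<in> edges (induced G (V\<^sub>1 \<union> X)) \<union> edges (induced G (V\<^sub>2 \<union> X))"
        proof (cases "e \<inter> X = {}")
          case True
          then have "e \<subseteq> V\<^sub>1 \<or> e \<subseteq> V\<^sub>2" using e eV E by blast
          then show ?thesis using e by (auto simp: induced_def)
        next
          case False
          then obtain u w where uw: "e = {u, w}" "u \<in> X"
            using simple_graph_edgeE[OF G e] by blast
          then have "w \<in> X \<union> V\<^sub>1 \<or> w \<in> X \<union> V\<^sub>2" using eV V by blast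
          then show ?thesis using uw e by (auto simp: induced_def)
        qed
      qed
      moreover have "finite (edges (induced G W))" for W
        using simple_graph_finite_edges[OF G] by (simp add: induced_def)
      ultimately have "card (edges G) \<le> card (edges (induced G (V\<^sub>1 \<union> X))) + card (edges (induced G (V\<^sub>2 \<union> X)))"
        by (meson card_Un_le card_mono finite_UnI le_trans)
      then have "real (card (edges G)) \<le> real (card (edges (induced G (V\<^sub>1 \<union> X)))) + real (card (edges (induced G (V\<^sub>2 \<union> X))))"
        by linarith
      also have "\<dots> \<le> a * (real (N V\<^sub>1) + real (N V\<^sub>2)) - a / 2 * (real (N V\<^sub>1) powr \<gamma> + real (N V\<^sub>2) powr \<gamma>)"
        using IH[OF V12(1) N_le(1)] IH[OF V12(2) N_le(2)] by (simp add: distrib_left)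
      also have "\<dots> \<le> a * (real n + \<delta> / 2 * real n powr \<gamma>) - a / 2 * ((1 + \<delta>) * real n powr \<gamma>)"
      proof (intro diff_mono mult_left_mono)
        have "real (N V\<^sub>1) + real (N V\<^sub>2) = real n + real (card X)" using N total by linarith
        then show "real (N V\<^sub>1) + real (N V\<^sub>2) \<le> real n + \<delta> / 2 * real n powr \<gamma>"
          using cX n\<^sub>0(2)[OF n(2)] by linarith
        have "real n \<le> real (N V\<^sub>1) + real (N V\<^sub>2)" using N total by linarith
        then have "(2/3) powr (\<gamma> - 1) * real n powr \<gamma> \<le> real (N V\<^sub>1) powr \<gamma> + real (N V\<^sub>2) powr \<gamma>"
          using n N_le \<gamma> by (intro powr_sum_ge) auto
        then show "(1 + \<delta>) * real n powr \<gamma> \<le> real (N V\<^sub>1) powr \<gamma> + real (N V\<^sub>2) powr \<gamma>"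
          by (simp add: \<delta>_def)
      qed (use \<open>0 \<le> a\<close> in auto)
      also have "\<dots> = a * real n - a / 2 * real n powr \<gamma>" by (simp add: algebra_simps)
      finally show ?thesis by (simp add: n_def)
    qed
  qed
  show ?thesis
  proof (intro exI[of _ a] conjI ballI)
    fix G assume "G \<in> \<G>"
    moreover have "0 \<le> a / 2 * real (card (verts G)) powr \<gamma>" using \<open>0 \<le> a\<close> by simp
    ultimately show "real (card (edges G)) \<le> a * real (card (verts G))" using bound[of G] by linarith
  qed fact
qed

section \<open>The recursion along separators\<close>

lemma forest_ineqs_formulation:
  fixes \<G> :: "'a ugraph set" and \<beta> c :: real
  assumes simple: "\<And>G. G \<in> \<G> \<Longrightarrow> simple_graph G"
    and closed: "closed_under_induced_subgraphs \<G>"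
    and \<beta>: "0 < \<beta>" "\<beta> < 1"
    and sep: "\<And>G. G \<in> \<G> \<Longrightarrow> 0 < card (verts G) \<Longrightarrow>
      \<exists>X. balanced_separator (1/2) G X \<and> real (card X) \<le> c * real (card (verts G)) powr \<beta>"
  shows "\<exists>K. \<forall>G\<in>\<G>. \<exists>m. formulation (edges G) (forest_ineqs G) m
    \<and> real m \<le> K * real (card (verts G)) powr (1 + \<beta>)"
proof -
  obtain a where a: "0 \<le> a" "\<And>G. G \<in> \<G> \<Longrightarrow> real (card (edges G)) \<le> a * real (card (verts G))"
    using linearly_many_edges[OF simple closed \<beta>(2) sep] by blast
  define q :: real where "q = (1/2) powr \<beta>"
  have q: "q < 1" using \<beta> by (auto simp: q_def powr_def intro!: mult_pos_neg)
  \<comment> \<open>\<open>K\<close> solves \<open>K * q + \<bar>c\<bar> * (2 * a + 1) = K\<close>: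
    the sides cost the fraction \<open>q\<close> of the bound, and the root systems of
    \<open>X\<close> cost the rest. The absolute value keeps \<open>K\<close> nonnegative for any
    sign of \<open>c\<close>.\<close>
  define K where "K = \<bar>c\<bar> * (2 * a + 1) / (1 - q)"
  have K: "0 \<le> K" "K * q + \<bar>c\<bar> * (2 * a + 1) = K"
    using q a by (auto simp: K_def field_simps)
  have "\<exists>m. formulation (edges G) (forest_ineqs G) m \<and> real m \<le> K * real (card (verts G)) powr (1 + \<beta>)"
    if "G \<in> \<G>" for G
    using that
  proof (induction "card (verts G)" arbitrary: G rule: less_induct)
    case less
    define n where "n = card (verts G)"
    have G: "simple_graph G" using less.prems by (rule simple)
    have finV: "finite (verts G)" using G by (simp add: simple_graph_def)
    have finE: "finite (edges G)" using G by (rule simple_graph_finite_edges)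
    show ?case
    proof (cases "n = 0")
      case True
      then have "verts G = {}" using finV by (simp add: n_def)
      moreover from this have "edges G = {}" using G by (auto simp: simple_graph_def)
      \<comment> \<open>The claimed bound is 0 for the empty graph, so the base case needs a system
        without inequalities.\<close>
      ultimately have "forest_ineqs G = UNIV" by (auto simp: forest_ineqs_def)
      then show ?thesis using formulation_UNIV True by (intro exI[of _ 0]) (simp add: n_def)
    next
      case False
      then have n: "0 < n" by simp
      obtain X where "balanced_separator (1/2) G X" and cX: "real (card X) \<le> c * real n powr \<beta>"
        using sep[OF less.prems] n by (auto simp: n_def)
      then obtain V\<^sub>1 V\<^sub>2 where X: "X \<subseteq> verts G" and disj: "V\<^sub>1 \<inter> V\<^sub>2 = {}"
        and VE: "induced G (verts G - X) = graph_union (induced G V\<^sub>1) (induced G V\<^sub>2)"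
        and half: "real (card V\<^sub>1) \<le> 1/2 * real n" "real (card V\<^sub>2) \<le> 1/2 * real n"
        by (auto simp: balanced_separator_def n_def)
      have V: "V\<^sub>1 \<union> V\<^sub>2 = verts G - X" by (rule induced_eq_graph_unionD(1)[OF VE])
      have IH: "\<exists>m. formulation (edges G) (forest_ineqs (induced G W)) m \<and> real m \<le> K * real (card W) powr (1 + \<beta>)"
        if "W \<subseteq> verts G" "real (card W) \<le> 1/2 * real n" for W
      proof -
        have "induced G W \<in> \<G>"
          using closed less.prems that by (simp add: closed_under_induced_subgraphs_def)
        moreover have "card (verts (induced G W)) < card (verts G)"
          using that n by (simp add: induced_def n_def)
        ultimately obtain m where "formulation (edges (induced G W)) (forest_ineqs (induced G W)) m"
            "real m \<le> K * real (card W) powr (1 + \<beta>)"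
          using less.hyps[of "induced G W"] by (auto simp: induced_def)
        moreover have "edges (induced G W) \<subseteq> edges G" by (auto simp: induced_def)
        ultimately show ?thesis using formulation_mono finE by blast
      qed
      obtain m\<^sub>1 where m\<^sub>1: "formulation (edges G) (forest_ineqs (induced G V\<^sub>1)) m\<^sub>1"
          "real m\<^sub>1 \<le> K * real (card V\<^sub>1) powr (1 + \<beta>)"
        using IH[OF _ half(1)] V by blast
      obtain m\<^sub>2 where m\<^sub>2: "formulation (edges G) (forest_ineqs (induced G V\<^sub>2)) m\<^sub>2"
          "real m\<^sub>2 \<le> K * real (card V\<^sub>2) powr (1 + \<beta>)"
        using IH[OF _ half(2)] V by blast
      define s where "s = 2 * card (edges G) + card (verts G)"
      define m where "m = m\<^sub>1 + m\<^sub>2 + card X * s"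
      have "formulation (edges G) (forest_ineqs G) m"
        unfolding forest_ineqs_separator[OF G X disj VE] m_def
        using m\<^sub>1 m\<^sub>2 finite_subset[OF X finV] formulation_orientable[OF G]
        by (intro formulation_Int formulation_INT) (simp_all add: s_def)
      moreover have "real m \<le> K * real n powr (1 + \<beta>)"
      proof -
        have "card (V\<^sub>1 \<union> V\<^sub>2) \<le> n" using V finV by (simp add: n_def card_mono)
        moreover have "card (V\<^sub>1 \<union> V\<^sub>2) = card V\<^sub>1 + card V\<^sub>2"
        proof (intro card_Un_disjoint disj)
          have "finite (V\<^sub>1 \<union> V\<^sub>2)" using V finV by simp
          then show "finite V\<^sub>1" "finite V\<^sub>2" by simp_all
        qed
        ultimately have "real (card V\<^sub>1) + real (card V\<^sub>2) \<le> real n" by linarith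
        then have "real (card V\<^sub>1) powr (1 + \<beta>) + real (card V\<^sub>2) powr (1 + \<beta>) \<le> q * real n powr (1 + \<beta>)"
          unfolding q_def using half \<beta> by (intro powr_sum_le) auto
        then have "K * (real (card V\<^sub>1) powr (1 + \<beta>) + real (card V\<^sub>2) powr (1 + \<beta>)) \<le> K * (q * real n powr (1 + \<beta>))"
          using K by (intro mult_left_mono)
        moreover have "real (card X) * real s \<le> \<bar>c\<bar> * (2 * a + 1) * real n powr (1 + \<beta>)"
        proof -
          have "c * real n powr \<beta> \<le> \<bar>c\<bar> * real n powr \<beta>" by (intro mult_right_mono) auto
          moreover have "real s \<le> (2 * a + 1) * real n"
            using a(2)[OF less.prems] by (simp add: s_def n_def distrib_right)
          ultimately have "real (card X) * real s \<le> (\<bar>c\<bar> * real n powr \<beta>) * ((2 * a + 1) * real n)"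
            using cX by (intro mult_mono) auto
          also have "\<dots> = \<bar>c\<bar> * (2 * a + 1) * real n powr (1 + \<beta>)"
            by (simp add: powr_mult_base[symmetric])
          finally show ?thesis .
        qed
        ultimately have "real m \<le> K * (q * real n powr (1 + \<beta>)) + \<bar>c\<bar> * (2 * a + 1) * real n powr (1 + \<beta>)"
          using m\<^sub>1 m\<^sub>2 by (simp add: m_def distrib_left)
        also have "\<dots> = (K * q + \<bar>c\<bar> * (2 * a + 1)) * real n powr (1 + \<beta>)"
          by (simp only: distrib_right mult.assoc)
        finally show ?thesis using K by simp
      qed
      ultimately show ?thesis unfolding n_def by blast
    qed
  qed
  then show ?thesis by blast
qed

theorem theorem2:
  fixes \<G> :: "'a ugraph set" and \<beta> :: real
  assumes "graph_class \<G>"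
    and "closed_under_induced_subgraphs \<G>"
    and "0 < \<beta>" and "\<beta> < 1"
    and "\<exists>c::real. \<forall>n::nat. n > 0 \<longrightarrow>
           (\<forall>G\<in>\<G>. card (verts G) = n \<longrightarrow>
              (\<exists>X. balanced_separator (1/2) G X \<and> real (card X) \<le> c * real n powr \<beta>))"
  shows "\<exists>C::real. \<forall>n::nat. n > 0 \<longrightarrow>
           (\<forall>G\<in>\<G>. card (verts G) = n \<longrightarrow>
              ereal_of_enat (xc (edges G) (forest_polytope G)) \<le> ereal (C * real n powr (1 + \<beta>)))"
proof -
  have simple: "simple_graph G" if "G \<in> \<G>" for G
    using assms(1) that by (simp add: graph_class_def)
  obtain c where "\<And>G. G \<in> \<G> \<Longrightarrow> 0 < card (verts G) \<Longrightarrow>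
      \<exists>X. balanced_separator (1/2) G X \<and> real (card X) \<le> c * real (card (verts G)) powr \<beta>"
    using assms(5) by blast
  from forest_ineqs_formulation[OF simple assms(2-4) this] obtain K where
    K: "\<forall>G\<in>\<G>. \<exists>m. formulation (edges G) (forest_ineqs G) m
      \<and> real m \<le> K * real (card (verts G)) powr (1 + \<beta>)" by blast
  have "ereal_of_enat (xc (edges G) (forest_polytope G)) \<le> ereal (K * real (card (verts G)) powr (1 + \<beta>))"
    if G: "G \<in> \<G>" for G
  proof -
    obtain m where m: "formulation (edges G) (forest_ineqs G) m"
        "real m \<le> K * real (card (verts G)) powr (1 + \<beta>)"
      using K G by blast
    have "has_extended_formulation (edges G) (forest_polytope G) m"
      using has_extended_formulation_if_formulation[OF m(1)]
      by (simp add: forest_polytope_eq[OF simple[OF G]])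
    then have "xc (edges G) (forest_polytope G) \<le> enat m"
      unfolding xc_def by (intro INF_lower) simp
    then have "ereal_of_enat (xc (edges G) (forest_polytope G)) \<le> ereal_of_enat (enat m)"
      by (simp only: ereal_of_enat_le_iff)
    also have "\<dots> \<le> ereal (K * real (card (verts G)) powr (1 + \<beta>))" using m(2) by simp
    finally show ?thesis .
  qed
  then show ?thesis by blast
qed

end
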